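(* Let $m\ge2$, let $\lambda$ be a primitive $m$-th root of unity, and let $W=\mathbb{Z}/m\mathbb{Z}$ act on the one-dimensional space $\mathfrak{h}=\mathbb{C}$ by $j\mapsto\lambda^{-j}$. Let $U=U(\mathbb{C})$ be the set of parameters $c\in C$ for which the irreducible lowest weight representation $L_c(\mathbb{C})$ of $H_c(W,\mathfrak{h})$, with trivial lowest weight, is unitary. In terms of the real linear coordinates $(b_1,\dots,b_{m-1})$ on $C\cong\mathbb{R}^{m-1}$, $U$ is the set of all vectors $(b_1,\dots,b_{m-1})$ such that in the vector $(1-b_1,2-b_2,\dots,m-1-b_{m-1})$ all the entries preceding the first zero entry are positive (if there are no zero entries, all entries must be positive).
   Context: Parameters are functions $c$ on the set of reflections $S=W\setminus\{0\}=\{1,\dots,m-1\}$, $c_j=c(j)\in\mathbb{C}$. $C$ is the set of $c$ with $c_{m-j}=\overline{c_j}$ for all $j$. For $n\ge0$ put $$b_n=2\sum_{j=1}^{m-1}\frac{1-\lambda^{jn}}{1-\lambda^j}c_j .$$ For $c\in C$ the $b_n$ are real, $b_0=0$, $b_{n+m}=b_n$, and $(b_1,\dots,b_{m-1})$ is a real linear coordinate system on $C$. With $y$ a unit basis vector of $\mathfrak{h}$ and $x$ the dual basis vector of $\mathfrak{h}^*$, the algebra $H_c(W,\mathfrak{h})$ is generated by $\mathbb{C}W$, $x$, $y$ with the generator action of $j\in W$ on $x$ by $\lambda^j$ and on $y$ by $\lambda^{-j}$, and $[y,x]=1-2\sum_{j=1}^{m-1}c_j\,[j]$, where $[j]$ is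 the element $j\in W$. $M_c(\mathbb{C})=H_c\otimes_{\mathbb{C}W\ltimes\mathbb{C}[y]}\mathbb{C}$ (with $W$ trivial and $y=0$ on $\mathbb{C}$) has basis $x^n$, $n\ge0$; $L_c(\mathbb{C})$ is its unique irreducible quotient. For $c\in C$ there is a unique $W$-invariant Hermitian form on $M_c(\mathbb{C})$ with $(1,1)=1$ and $(yv,v')=(v,xv')$; its kernel is the maximal proper submodule, and $L_c(\mathbb{C})$ is unitary if the induced form on it is positive definite. *)

theory Defs
  imports Complex_Main "HOL-Library.FuncSet" "HOL-Library.Poly_Mapping" "HOL-Algebra.QuotRing" "HOL-Algebra.Module"
    "HOL-Algebra.Free_Abelian_Groups"
begin

section \<open>The free algebra on \<open>x\<close>, \<open>y\<close> and \<open>W\<close>\<close>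

text \<open>The element of \<open>W = \<int>/m\<close> represented by \<open>j\<close> gives the generator \<^term>\<open>LetW j\<close>; generators
  of congruent representatives are identified by the relations below.\<close>

datatype letter = LetX | LetY | LetW nat

datatype word = Word "letter list"

text \<open>Words form a monoid under concatenation (written additively, because this is what the
  convolution product on \<^typ>\<open>word \<Rightarrow>\<^sub>0 complex\<close> is based on).\<close>

instantiation word :: monoid_add
begin

definition zero_word :: word where
  "0 = Word []"

fun plus_word :: "word \<Rightarrow> word \<Rightarrow> word" where
  "Word u + Word v = Word (u @ v)"

instance
proof
  fix a b c :: word
  show "a + b + c = a + (b + c)" by (cases a; cases b; cases c) simp
  show "0 + a = a" by (cases a) (simp add: zero_word_def)
  show "a + 0 = a" by (cases a) (simp add: zero_word_def)
qed

end

type_synonym free_alg = "word \<Rightarrow>\<^sub>0 complex"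

definition free_ring :: "free_alg ring" where
  "free_ring = \<lparr>carrier = UNIV, monoid.mult = (*), one = 1, ring.zero = 0, ring.add = (+)\<rparr>"

definition fscal :: "complex \<Rightarrow> free_alg" where
  "fscal z = Poly_Mapping.single 0 z"

definition flet :: "letter \<Rightarrow> free_alg" where
  "flet l = Poly_Mapping.single (Word [l]) 1"

abbreviation fx :: free_alg where "fx \<equiv> flet LetX"
abbreviation fy :: free_alg where "fy \<equiv> flet LetY"
abbreviation fw :: "nat \<Rightarrow> free_alg" where "fw j \<equiv> flet (LetW j)"


section \<open>The algebra \<open>H\<^sub>c(W, \<hh>)\<close>\<close>

definition primitive_root_of_unity :: "nat \<Rightarrow> complex \<Rightarrow> bool" where
  "primitive_root_of_unity m l \<longleftrightarrow> l ^ m = 1 \<and> (\<forall>k\<in>{1..<m}. l ^ k \<noteq> 1)"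

text \<open>The first three families present \<open>\<complex>W\<close>. The generator of \<open>\<hh>\<close> is \<open>y\<close>, on which \<open>j\<close> acts by
  \<open>\<lambda>\<^sup>-\<^sup>j\<close>; hence it acts by \<open>\<lambda>\<^sup>j\<close> on the dual vector \<open>x\<close>.\<close>

definition cherednik_rels :: "nat \<Rightarrow> complex \<Rightarrow> (nat \<Rightarrow> complex) \<Rightarrow> free_alg set" where
  "cherednik_rels m l c =
     {fw j - fw (j mod m) | j. True}
   \<union> {fw 0 - 1}
   \<union> {fw i * fw j - fw (i + j) | i j. True}
   \<union> {fw j * fx - fscal (l ^ j) * fx * fw j | j. True}
   \<union> {fw j * fy - fscal (inverse (l ^ j)) * fy * fw j | j. True}
   \<union> {fy * fx - fx * fy - (1 - fscal 2 * (\<Sum>j=1..m-1. fscal (c j) * fw j))}"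

definition cherednik :: "nat \<Rightarrow> complex \<Rightarrow> (nat \<Rightarrow> complex) \<Rightarrow> free_alg set ring" where
  "cherednik m l c = free_ring Quot (Idl\<^bsub>free_ring\<^esub> (cherednik_rels m l c))"

definition hcl :: "nat \<Rightarrow> complex \<Rightarrow> (nat \<Rightarrow> complex) \<Rightarrow> free_alg \<Rightarrow> free_alg set" where
  "hcl m l c a = (Idl\<^bsub>free_ring\<^esub> (cherednik_rels m l c)) +>\<^bsub>free_ring\<^esub> a"


section \<open>Left modules over a not necessarily commutative ring\<close>

text \<open>We use the record \<open>module\<close> and the locale \<^locale>\<open>submodule\<close> of HOL-Algebra, neither of which
  presupposes commutativity of the ring. The fields \<open>mult\<close> and \<open>one\<close> of a module record are
  meaningless.\<close>

definition quot_module :: "('r, 'a) module \<Rightarrow> 'a set \<Rightarrow> ('r, 'a set) module" where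
  "quot_module M N =
     \<lparr>carrier = a_rcosets\<^bsub>M\<^esub> N, monoid.mult = undefined, one = undefined, ring.zero = N, ring.add = set_add M,
      smult = (\<lambda>r U. \<Union>u\<in>U. N +>\<^bsub>M\<^esub> (r \<odot>\<^bsub>M\<^esub> u))\<rparr>"

definition irreducible_module :: "'r ring \<Rightarrow> ('r, 'a) module \<Rightarrow> bool" where
  "irreducible_module R M \<longleftrightarrow>
     carrier M \<noteq> {\<zero>\<^bsub>M\<^esub>} \<and>
     (\<forall>N. submodule N R M \<longrightarrow> N = {\<zero>\<^bsub>M\<^esub>} \<or> N = carrier M)"


section \<open>The module \<open>M\<^sub>c(\<complex>) = H\<^sub>c \<otimes>\<^sub>A \<complex>\<close>, where \<open>A = \<complex>W \<ltimes> \<complex>[y]\<close>\<close>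

text \<open>\<open>triv_act m l c a s\<close>: the element \<open>a\<close> of the subalgebra \<open>A\<close> of \<open>H\<^sub>c\<close> generated by \<open>\<complex>W\<close> and \<open>y\<close>
  acts on the \<open>A\<close>-module \<open>\<complex>\<close> (\<open>W\<close> trivial, \<open>y = 0\<close>) as multiplication by \<open>s\<close>.\<close>

inductive triv_act ::
  "nat \<Rightarrow> complex \<Rightarrow> (nat \<Rightarrow> complex) \<Rightarrow> free_alg set \<Rightarrow> complex \<Rightarrow> bool" for m l c where
  scal: "triv_act m l c (hcl m l c (fscal z)) z"
| grp:  "triv_act m l c (hcl m l c (fw j)) 1"
| y:    "triv_act m l c (hcl m l c fy) 0"
| add:  "triv_act m l c a s \<Longrightarrow> triv_act m l c b t \<Longrightarrow>
           triv_act m l c (a \<oplus>\<^bsub>cherednik m l c\<^esub> b) (s + t)"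
| mul: "triv_act m l c a s \<Longrightarrow> triv_act m l c b t \<Longrightarrow>
           triv_act m l c (a \<otimes>\<^bsub>cherednik m l c\<^esub> b) (s * t)"

text \<open>The tensor product is the free abelian group on the pairs \<open>(h, z)\<close>, modulo biadditivity and
  \<open>(h a, z) = (h, a z)\<close> for \<open>a \<in> A\<close>; here \<open>H\<^sub>c\<close> acts by left multiplication on \<open>h\<close>.\<close>

definition tensor_free ::
  "nat \<Rightarrow> complex \<Rightarrow> (nat \<Rightarrow> complex) \<Rightarrow> (free_alg set, (free_alg set \<times> complex) \<Rightarrow>\<^sub>0 int) module"
  where
  "tensor_free m l c =
     \<lparr>carrier = carrier (free_Abelian_group (carrier (cherednik m l c) \<times> UNIV)),
      monoid.mult = undefined, one = undefined, ring.zero = 0, ring.add = (+),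
      smult = (\<lambda>h. frag_extend (\<lambda>(k, z). frag_of (h \<otimes>\<^bsub>cherednik m l c\<^esub> k, z)))\<rparr>"

definition tensor_rels ::
  "nat \<Rightarrow> complex \<Rightarrow> (nat \<Rightarrow> complex) \<Rightarrow> ((free_alg set \<times> complex) \<Rightarrow>\<^sub>0 int) set" where
  "tensor_rels m l c = (let H = cherednik m l c in
     {frag_of (h \<oplus>\<^bsub>H\<^esub> k, z) - frag_of (h, z) - frag_of (k, z) | h k z.
        h \<in> carrier H \<and> k \<in> carrier H}
   \<union> {frag_of (h, z + z') - frag_of (h, z) - frag_of (h, z') | h z z'. h \<in> carrier H}
   \<union> {frag_of (h \<otimes>\<^bsub>H\<^esub> a, z) - frag_of (h, s * z) | h a s z.
        h \<in> carrier H \<and> triv_act m l c a s})"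

definition tensor_null ::
  "nat \<Rightarrow> complex \<Rightarrow> (nat \<Rightarrow> complex) \<Rightarrow> ((free_alg set \<times> complex) \<Rightarrow>\<^sub>0 int) set" where
  "tensor_null m l c = generate (add_monoid (tensor_free m l c)) (tensor_rels m l c)"

type_synonym verma_elt = "((free_alg set \<times> complex) \<Rightarrow>\<^sub>0 int) set"

definition verma ::
  "nat \<Rightarrow> complex \<Rightarrow> (nat \<Rightarrow> complex) \<Rightarrow> (free_alg set, verma_elt) module" where
  "verma m l c = quot_module (tensor_free m l c) (tensor_null m l c)"

text \<open>The lowest weight vector \<open>1 \<otimes> 1\<close>.\<close>

definition verma_one :: "nat \<Rightarrow> complex \<Rightarrow> (nat \<Rightarrow> complex) \<Rightarrow> verma_elt" where
  "verma_one m l c =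
     tensor_null m l c +>\<^bsub>tensor_free m l c\<^esub> frag_of (\<one>\<^bsub>cherednik m l c\<^esub>, 1)"


section \<open>The irreducible module \<open>L\<^sub>c(\<complex>)\<close>\<close>

definition verma_rad :: "nat \<Rightarrow> complex \<Rightarrow> (nat \<Rightarrow> complex) \<Rightarrow> verma_elt set" where
  "verma_rad m l c = (THE N. submodule N (cherednik m l c) (verma m l c) \<and>
     irreducible_module (cherednik m l c) (quot_module (verma m l c) N))"

definition irrep ::
  "nat \<Rightarrow> complex \<Rightarrow> (nat \<Rightarrow> complex) \<Rightarrow> (free_alg set, verma_elt set) module" where
  "irrep m l c = quot_module (verma m l c) (verma_rad m l c)"


section \<open>Unitarity\<close>

text \<open>Hermitian forms are linear in the first argument. Only the values of \<open>B\<close> on the carrier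
  matter.\<close>

definition contravariant_form ::
  "nat \<Rightarrow> complex \<Rightarrow> (nat \<Rightarrow> complex) \<Rightarrow> (verma_elt \<Rightarrow> verma_elt \<Rightarrow> complex) \<Rightarrow> bool" where
  "contravariant_form m l c B \<longleftrightarrow> (let M = verma m l c; h = hcl m l c in
     (\<forall>u\<in>carrier M. \<forall>v\<in>carrier M. \<forall>w\<in>carrier M. B (u \<oplus>\<^bsub>M\<^esub> v) w = B u w + B v w) \<and>
     (\<forall>z. \<forall>v\<in>carrier M. \<forall>w\<in>carrier M. B (h (fscal z) \<odot>\<^bsub>M\<^esub> v) w = z * B v w) \<and>
     (\<forall>v\<in>carrier M. \<forall>w\<in>carrier M. B w v = cnj (B v w)) \<and>
     (\<forall>j. \<forall>v\<in>carrier M. \<forall>w\<in>carrier M. B (h (fw j) \<odot>\<^bsub>M\<^esub> v) (h (fw j) \<odot>\<^bsub>M\<^esub> w) = B v w) \<and>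
     B (verma_one m l c) (verma_one m l c) = 1 \<and>
     (\<forall>v\<in>carrier M. \<forall>w\<in>carrier M. B (h fy \<odot>\<^bsub>M\<^esub> v) w = B v (h fx \<odot>\<^bsub>M\<^esub> w)))"

text \<open>The form induced on a quotient whose elements are cosets: the common value on
  representatives.\<close>

definition induced_form :: "('a \<Rightarrow> 'a \<Rightarrow> complex) \<Rightarrow> 'a set \<Rightarrow> 'a set \<Rightarrow> complex" where
  "induced_form B U V = (THE z. \<forall>u\<in>U. \<forall>v\<in>V. B u v = z)"

definition positive_definite :: "('r, 'a) module \<Rightarrow> ('a \<Rightarrow> 'a \<Rightarrow> complex) \<Rightarrow> bool" where
  "positive_definite M B \<longleftrightarrow>
     (\<forall>v\<in>carrier M. v \<noteq> \<zero>\<^bsub>M\<^esub> \<longrightarrow> B v v \<in> \<real> \<and> 0 < Re (B v v))"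

text \<open>For parameters in \<open>C\<close> the form is unique on the carrier, so that \<open>\<exists>\<close> just names it.\<close>

definition unitary :: "nat \<Rightarrow> complex \<Rightarrow> (nat \<Rightarrow> complex) \<Rightarrow> bool" where
  "unitary m l c \<longleftrightarrow>
     (\<exists>B. contravariant_form m l c B \<and> positive_definite (irrep m l c) (induced_form B))"


section \<open>Parameters and coordinates\<close>

definition params :: "nat \<Rightarrow> (nat \<Rightarrow> complex) set" where
  "params m = {c \<in> {1..<m} \<rightarrow>\<^sub>E UNIV. \<forall>j\<in>{1..<m}. c (m - j) = cnj (c j)}"

definition unitary_params :: "nat \<Rightarrow> complex \<Rightarrow> (nat \<Rightarrow> complex) set" where
  "unitary_params m l = {c \<in> params m. unitary m l c}"

definition bnum :: "nat \<Rightarrow> complex \<Rightarrow> (nat \<Rightarrow> complex) \<Rightarrow> nat \<Rightarrow> complex" where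
  "bnum m l c n = 2 * (\<Sum>j=1..m-1. (1 - l ^ (j * n)) / (1 - l ^ j) * c j)"

text \<open>The real part is only a type conversion: see \<open>bnum_eq_of_real_Re\<close>.\<close>

definition bcoords :: "nat \<Rightarrow> complex \<Rightarrow> (nat \<Rightarrow> complex) \<Rightarrow> (nat \<Rightarrow> real)" where
  "bcoords m l c = (\<lambda>n\<in>{1..<m}. Re (bnum m l c n))"

lemma bnum_eq_of_real_Re:
  assumes "m \<ge> 2" and "primitive_root_of_unity m l" and "c \<in> params m"
  shows "bnum m l c n = of_real (Re (bnum m l c n))"
proof -
  have lm: "l ^ m = 1" using assms by (simp add: primitive_root_of_unity_def)
  then have "norm l ^ m = 1 ^ m" by (metis norm_one norm_power power_one)
  then have "norm l = 1" using assms(1) power_eq_imp_eq_base [of "norm l" m 1] by simp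
  then have cnjl: "l * cnj l = 1" using complex_norm_square [of l] by simp
  have pow: "cnj l ^ j = l ^ (m - j)" if "j \<in> {1..m-1}" for j
  proof -
    have "l ^ j * cnj l ^ j = (l * cnj l) ^ j" by (rule power_mult_distrib [symmetric])
    then have 1: "l ^ j * cnj l ^ j = 1" by (simp add: cnjl)
    have "l ^ j * l ^ (m - j) = l ^ (j + (m - j))" by (rule power_add [symmetric])
    also have "j + (m - j) = m" using that by auto
    finally have 2: "l ^ j * l ^ (m - j) = 1" by (simp add: lm)
    have "l ^ j \<noteq> 0" using cnjl by auto
    with 1 2 show ?thesis by (metis mult_left_cancel)
  qed
  have "cnj (\<Sum>j=1..m-1. (1 - l ^ (j * n)) / (1 - l ^ j) * c j)
      = (\<Sum>j=1..m-1. (1 - l ^ ((m - j) * n)) / (1 - l ^ (m - j)) * c (m - j))"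
    unfolding cnj_sum
  proof (rule sum.cong [OF refl])
    fix j assume j: "j \<in> {1..m-1}"
    then have "c (m - j) = cnj (c j)" using assms(3) by (auto simp: params_def)
    then show "cnj ((1 - l ^ (j * n)) / (1 - l ^ j) * c j)
        = (1 - l ^ ((m - j) * n)) / (1 - l ^ (m - j)) * c (m - j)"
      using pow [OF j] by (simp add: power_mult)
  qed
  also have "\<dots> = (\<Sum>j=1..m-1. (1 - l ^ (j * n)) / (1 - l ^ j) * c j)"
    by (rule sum.reindex_bij_witness [of _ "\<lambda>j. m - j" "\<lambda>j. m - j"]) auto
  finally have "cnj (bnum m l c n) = bnum m l c n" by (simp add: bnum_def)
  then show ?thesis by (metis Reals_cnj_iff of_real_Re)
qed

definition positive_before_first_zero :: "nat \<Rightarrow> (nat \<Rightarrow> real) \<Rightarrow> bool" where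
  "positive_before_first_zero m a \<longleftrightarrow>
     (if \<exists>k\<in>{1..<m}. a k = 0
      then \<forall>k\<in>{1..<(LEAST k. k \<in> {1..<m} \<and> a k = 0)}. 0 < a k
      else \<forall>k\<in>{1..<m}. 0 < a k)"

end

theory Submission
  imports Defs "HOL-Computational_Algebra.Polynomial"
begin

text \<open>
The Verma module is the polynomial ring \<open>\<complex>[x]\<close>: the relations of the Cherednik algebra let
every element be moved into \<open>\<complex>[x]\<close> modulo the annihilator of the lowest weight vector, and the
Dunkl representation, in which \<open>y x\<^sup>n = \<mu>\<^sub>n x\<^sup>n\<^sup>-\<^sup>1\<close> with \<open>\<mu>\<^sub>n = n - b\<^sub>n\<close>, shows that the
powers of \<open>x\<close> stay independent there (\<open>\<Phi>_bij\<close>).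

On \<open>\<complex>[x]\<close> contravariance forces the form: \<open>(x\<^sup>n, x\<^sup>k) = 0\<close> for \<open>n \<noteq> k\<close> and
\<open>(x\<^sup>n, x\<^sup>n) = \<mu>\<^sub>1 \<cdots> \<mu>\<^sub>n\<close> (\<open>contravariant_form_unique\<close>). The maximal proper submodule
is the kernel of this form (\<open>verma_rad_eq\<close>). The point is that an invariant subspace contains the
constant terms of its elements, because an Euler element of the algebra multiplies \<open>x\<^sup>n\<close> by \<open>n\<close>,
and that \<open>y\<^sup>n\<close> maps \<open>x\<^sup>n\<close> to \<open>\<mu>\<^sub>1 \<cdots> \<mu>\<^sub>n\<close>; so an invariant subspace that is not inside the
kernel contains \<open>1\<close>. Hence the irreducible quotient is unitary if and only if all the products
\<open>\<mu>\<^sub>1 \<cdots> \<mu>\<^sub>n\<close> are nonnegative (\<open>unitary_iff_gram_nonneg\<close>).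

These products are nonnegative exactly if all \<open>\<mu>\<^sub>k\<close> before the first zero of \<open>\<mu>\<^sub>1, \<mu>\<^sub>2, \<dots>\<close> are
positive. Since \<open>\<mu>\<^sub>0 = 0\<close> and \<open>\<mu>\<^sub>k\<^sub>+\<^sub>m = \<mu>\<^sub>k + m\<close>, positivity of \<open>\<mu>\<^sub>1, \<dots>, \<mu>\<^sub>m\<^sub>-\<^sub>1\<close> gives it for
all later terms, so only these entries matter (\<open>partial_prods_nonneg_iff\<close>). Finally the differences
\<open>b\<^sub>n\<^sub>+\<^sub>1 - b\<^sub>n\<close> are twice the discrete Fourier transform of \<open>c\<close>, and Fourier inversion on \<open>\<int>/m\<close>
gives the coordinates (\<open>bcoords_inj\<close>, \<open>bcoords_surj\<close>).
\<close>

section \<open>Abelian groups with operators and their quotients\<close>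

text \<open>Submodules and irreducible quotients see the scalars only through the additive endomorphisms
  that they induce. The free abelian group behind the tensor product and the Verma module are both
  of this kind.\<close>

locale operator_group = abelian_group M for R :: "'r ring" and M :: "('r, 'a) module" (structure) +
  assumes smult_closed: "r \<in> carrier R \<Longrightarrow> x \<in> carrier M \<Longrightarrow> r \<odot> x \<in> carrier M"
    and smult_add: "r \<in> carrier R \<Longrightarrow> x \<in> carrier M \<Longrightarrow> y \<in> carrier M \<Longrightarrow> r \<odot> (x \<oplus> y) = r \<odot> x \<oplus> r \<odot> y"
begin

lemma submodule_abelian_subgroup:
  "submodule N R M \<Longrightarrow> abelian_subgroup N M"
  by (simp add: abelian_subgroupI3 additive_subgroupI abelian_group_axioms submodule.axioms(1))

lemma smult_zero: "r \<in> carrier R \<Longrightarrow> r \<odot> \<zero> = \<zero>"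
  using smult_add[of r \<zero> \<zero>] smult_closed[of r \<zero>] by simp

lemma smult_minus:
  assumes "r \<in> carrier R" "x \<in> carrier M" shows "r \<odot> (\<ominus> x) = \<ominus> (r \<odot> x)"
proof -
  have "r \<odot> (\<ominus> x) \<oplus> r \<odot> x = \<zero>"
    using smult_add[of r "\<ominus> x" x] assms smult_zero by (simp add: l_neg)
  then show ?thesis using assms by (simp add: minus_equality smult_closed)
qed

context
  fixes N assumes N: "submodule N R M"
begin

interpretation N: abelian_subgroup N M by (rule submodule_abelian_subgroup[OF N])

lemma carrier_quot: "carrier (quot_module M N) = (\<lambda>x. N +> x) ` carrier M"
  by (auto simp: quot_module_def A_RCOSETS_defs a_r_coset_def)

lemma zero_quot: "\<zero>\<^bsub>quot_module M N\<^esub> = N"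
  by (simp add: quot_module_def)

lemma add_quot:
  "x \<in> carrier M \<Longrightarrow> y \<in> carrier M \<Longrightarrow> (N +> x) \<oplus>\<^bsub>quot_module M N\<^esub> (N +> y) = N +> (x \<oplus> y)"
  by (simp add: quot_module_def N.a_rcos_sum)

lemma coset_eq_iff:
  assumes "x \<in> carrier M" "y \<in> carrier M"
  shows "N +> x = N +> y \<longleftrightarrow> x \<ominus> y \<in> N"
  using assms N.a_rcos_module[of y x] N.a_repr_independence'[of x y] N.a_rcos_self[of x]
  by (auto simp: a_minus_def)

lemma smult_quot:
  assumes "r \<in> carrier R" "x \<in> carrier M"
  shows "r \<odot>\<^bsub>quot_module M N\<^esub> (N +> x) = N +> (r \<odot> x)"
proof -
  have "N +> (r \<odot> u) = N +> (r \<odot> x)" if u: "u \<in> N +> x" for u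
  proof -
    have uc: "u \<in> carrier M" using N.a_elemrcos_carrier assms(2) u by blast
    have "u \<ominus> x \<in> N" using N.a_rcos_module assms(2) u uc by (simp add: a_minus_def)
    then have "r \<odot> (u \<ominus> x) \<in> N" using N assms(1) by (simp add: submodule.smult_closed)
    then have "r \<odot> u \<ominus> r \<odot> x \<in> N" using assms uc by (simp add: a_minus_def smult_add smult_minus)
    then show ?thesis using coset_eq_iff assms uc smult_closed by simp
  qed
  then have "(\<Union>u\<in>N +> x. N +> (r \<odot> u)) = (\<Union>u\<in>N +> x. N +> (r \<odot> x))"
    by (rule SUP_cong[OF refl])
  also have "\<dots> = N +> (r \<odot> x)" using N.a_rcos_self[OF assms(2)] by blast
  finally show ?thesis by (simp add: quot_module_def)
qed

lemma quot_operator_group: "operator_group R (quot_module M N)"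
proof -
  note simps = carrier_quot zero_quot add_quot
  have 0: "\<zero>\<^bsub>quot_module M N\<^esub> = N +> \<zero>" using N.a_rcos_const[of \<zero>] by (simp add: zero_quot)
  have inv: "\<exists>y\<in>carrier (quot_module M N). y \<oplus>\<^bsub>quot_module M N\<^esub> (N +> x) = N +> \<zero>" if "x \<in> carrier M" for x
    using that by (intro bexI[of _ "N +> (\<ominus> x)"]) (auto simp: simps l_neg)
  have "abelian_group (quot_module M N)"
    by (rule abelian_groupI)
      (use inv in \<open>auto simp: carrier_quot add_quot 0 a_ac\<close>)
  moreover have "operator_group_axioms R (quot_module M N)"
    by (rule operator_group_axioms.intro)
      (auto simp: carrier_quot smult_quot add_quot smult_closed smult_add)
  ultimately show ?thesis by (rule operator_group.intro)
qed

lemma coset_eq_self_iff: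
  assumes "x \<in> carrier M" shows "N +> x = N \<longleftrightarrow> x \<in> N"
  using assms coset_eq_iff[of x \<zero>] N.a_rcos_const[of \<zero>] minus_equality[of \<zero> \<zero>]
  by (simp add: a_minus_def)

end

lemma submoduleI:
  assumes "H \<subseteq> carrier M" "\<zero> \<in> H" "\<And>a. a \<in> H \<Longrightarrow> \<ominus> a \<in> H"
    "\<And>a b. a \<in> H \<Longrightarrow> b \<in> H \<Longrightarrow> a \<oplus> b \<in> H"
    "\<And>a x. a \<in> carrier R \<Longrightarrow> x \<in> H \<Longrightarrow> a \<odot> x \<in> H"
  shows "submodule H R M"
  apply (intro submodule.intro subgroup.intro)
  using assms by (simp_all add: a_inv_def submodule_axioms_def)

lemma submoduleD:
  assumes "submodule H R M"
  shows "H \<subseteq> carrier M" "\<zero> \<in> H" "a \<in> H \<Longrightarrow> \<ominus> a \<in> H" "a \<in> H \<Longrightarrow> b \<in> H \<Longrightarrow> a \<oplus> b \<in> H"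
    "r \<in> carrier R \<Longrightarrow> a \<in> H \<Longrightarrow> r \<odot> a \<in> H"
proof -
  interpret N: abelian_subgroup H M by (rule submodule_abelian_subgroup[OF assms])
  show "H \<subseteq> carrier M" "\<zero> \<in> H" "a \<in> H \<Longrightarrow> \<ominus> a \<in> H" "a \<in> H \<Longrightarrow> b \<in> H \<Longrightarrow> a \<oplus> b \<in> H"
    using N.a_Hcarr by auto
  show "r \<in> carrier R \<Longrightarrow> a \<in> H \<Longrightarrow> r \<odot> a \<in> H"
    using assms by (simp add: submodule.smult_closed)
qed

lemma minus_quot:
  assumes N: "submodule N R M" and x: "x \<in> carrier M"
  shows "\<ominus>\<^bsub>quot_module M N\<^esub> (N +> x) = N +> (\<ominus> x)"
proof -
  interpret Q: operator_group R "quot_module M N" by (rule quot_operator_group[OF N])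
  show ?thesis
  proof (rule Q.minus_equality)
    show "(N +> (\<ominus> x)) \<oplus>\<^bsub>quot_module M N\<^esub> (N +> x) = \<zero>\<^bsub>quot_module M N\<^esub>"
      using x by (simp add: add_quot[OF N] zero_quot[OF N] l_neg coset_eq_self_iff[OF N] submoduleD(2)[OF N])
  qed (use x in \<open>auto simp: carrier_quot[OF N]\<close>)
qed

text \<open>By the correspondence between the submodules of \<open>M / N\<close> and those of \<open>M\<close> that contain \<open>N\<close>,
  irreducibility of a quotient can be decided in \<open>M\<close>, where it becomes a statement about invariant
  subspaces of a concrete space.\<close>

lemma irreducible_quot_iff_maximal:
  assumes N: "submodule N R M"
  shows "irreducible_module R (quot_module M N) \<longleftrightarrow>
    N \<noteq> carrier M \<and> (\<forall>P. submodule P R M \<and> N \<subseteq> P \<longrightarrow> P = N \<or> P = carrier M)"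
proof -
  let ?Q = "quot_module M N"
  interpret Q: operator_group R ?Q by (rule quot_operator_group[OF N])
  note simps = carrier_quot[OF N] zero_quot[OF N] add_quot[OF N] smult_quot[OF N] minus_quot[OF N]
  note D = submoduleD[OF N]
  have self: "N +> x = N \<longleftrightarrow> x \<in> N" if "x \<in> carrier M" for x
    using coset_eq_self_iff[OF N that] .
  have triv: "carrier ?Q = {N} \<longleftrightarrow> N = carrier M"
  proof
    assume "carrier ?Q = {N}"
    then have "N +> x = N" if "x \<in> carrier M" for x using that by (auto simp: simps)
    then show "N = carrier M" using D(1) self by auto
  next
    assume "N = carrier M"
    then have "\<And>x. x \<in> carrier M \<Longrightarrow> N +> x = N" using self by simp
    then have "(+>) N ` carrier M = (\<lambda>_. N) ` carrier M" by (rule image_cong[OF refl])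
    then show "carrier ?Q = {N}" unfolding carrier_quot[OF N] using zero_closed by auto
  qed
  show ?thesis
  proof
    assume irr: "irreducible_module R ?Q"
    have "P = N \<or> P = carrier M" if P: "submodule P R M" "N \<subseteq> P" for P
    proof -
      note PD = submoduleD[OF P(1)]
      have "submodule ((+>) N ` P) R ?Q"
      proof (rule Q.submoduleI)
        show "(+>) N ` P \<subseteq> carrier ?Q" unfolding simps using PD(1) by blast
        have "N +> \<zero> = N" using self D(2) by simp
        then show "\<zero>\<^bsub>?Q\<^esub> \<in> (+>) N ` P" unfolding simps using PD(2) by (metis imageI)
        show "\<ominus>\<^bsub>?Q\<^esub> a \<in> (+>) N ` P" if "a \<in> (+>) N ` P" for a
          using that PD(1,3) by (auto simp: simps subset_iff)
        show "a \<oplus>\<^bsub>?Q\<^esub> b \<in> (+>) N ` P" if "a \<in> (+>) N ` P" "b \<in> (+>) N ` P" for a b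
          using that PD(1,4) by (auto simp: simps subset_iff)
        show "r \<odot>\<^bsub>?Q\<^esub> a \<in> (+>) N ` P" if "r \<in> carrier R" "a \<in> (+>) N ` P" for r a
          using that PD(1,5) by (auto simp: simps subset_iff)
      qed
      then consider "(+>) N ` P = {N}" | "(+>) N ` P = carrier ?Q"
        using irr unfolding irreducible_module_def zero_quot[OF N] by blast
      then show ?thesis
      proof cases
        case 1
        then have "N +> x = N" if "x \<in> P" for x using that by (metis imageI singletonD)
        then have "P \<subseteq> N" using self PD(1) by (metis subset_iff)
        then show ?thesis using P(2) by blast
      next
        case 2
        have "x \<in> P" if x: "x \<in> carrier M" for x
        proof -
          have "N +> x \<in> (+>) N ` P" unfolding 2 simps using x by (rule imageI)
          then obtain p where p: "p \<in> P" "N +> x = N +> p" by (elim imageE)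
          have "p \<in> carrier M" using p(1) PD(1) by (rule rev_subsetD)
          then have "x \<ominus> p \<in> N" by (rule coset_eq_iff[OF N x, THEN iffD1, OF _ p(2)])
          then have "x \<ominus> p \<in> P" using P(2) by (rule rev_subsetD)
          then have "(x \<ominus> p) \<oplus> p \<in> P" using p PD(4) by simp
          then show ?thesis using x p PD(1) by (simp add: a_minus_def a_assoc subset_iff l_neg)
        qed
        then show ?thesis using PD(1) by blast
      qed
    qed
    then show "N \<noteq> carrier M \<and> (\<forall>P. submodule P R M \<and> N \<subseteq> P \<longrightarrow> P = N \<or> P = carrier M)"
      using irr triv unfolding irreducible_module_def zero_quot[OF N] by blast
  next
    assume max: "N \<noteq> carrier M \<and> (\<forall>P. submodule P R M \<and> N \<subseteq> P \<longrightarrow> P = N \<or> P = carrier M)"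
    have "S = {N} \<or> S = carrier ?Q" if S: "submodule S R ?Q" for S
    proof -
      note SD = Q.submoduleD[OF S]
      define P where "P = {x \<in> carrier M. N +> x \<in> S}"
      have "submodule P R M"
      proof (rule submoduleI)
        show "\<zero> \<in> P" using SD(2) self[of \<zero>] D(2) by (simp add: P_def simps)
        show "\<ominus> a \<in> P" if "a \<in> P" for a
          using that SD(3)[of "N +> a"] by (simp add: P_def simps)
        show "a \<oplus> b \<in> P" if "a \<in> P" "b \<in> P" for a b
          using that SD(4)[of "N +> a" "N +> b"] by (simp add: P_def simps)
        show "a \<odot> b \<in> P" if "a \<in> carrier R" "b \<in> P" for a b
          using that SD(5)[of a "N +> b"] by (simp add: P_def simps smult_closed)
      qed (auto simp: P_def)
      moreover have "N \<subseteq> P"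
      proof
        fix x assume x: "x \<in> N"
        then have xc: "x \<in> carrier M" using D(1) by (rule rev_subsetD)
        then have "N +> x = N" using self x by simp
        then show "x \<in> P" using SD(2) xc by (simp add: P_def zero_quot[OF N])
      qed
      moreover have S_eq: "S = (+>) N ` P" using SD(1) by (auto simp: P_def simps)
      ultimately consider "P = N" | "P = carrier M" using max by blast
      then show ?thesis
      proof cases
        case 1
        then have "S = (+>) N ` N" using S_eq by simp
        also have "\<dots> = (\<lambda>_. N) ` N" by (rule image_cong[OF refl]) (use self D(1) in \<open>simp add: subset_iff\<close>)
        also have "\<dots> = {N}" using D(2) by auto
        finally show ?thesis ..
      next
        case 2 then show ?thesis using S_eq by (simp add: simps)
      qed
    qed
    then show "irreducible_module R ?Q"
      using max triv unfolding irreducible_module_def zero_quot[OF N] by blast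
  qed
qed

end

section \<open>The free algebra and its representations\<close>

text \<open>A finitely supported function is a sum of functions supported at one point.\<close>

lemma poly_mapping_additive_induct [case_names zero single add]:
  fixes a :: "'a \<Rightarrow>\<^sub>0 'b::monoid_add"
  assumes "P 0" "\<And>k v. P (Poly_Mapping.single k v)" "\<And>a b. P a \<Longrightarrow> P b \<Longrightarrow> P (a + b)"
  shows "P a"
proof (induction a rule: update_induct)
  case const show ?case by (rule assms(1))
next
  case (update f k v)
  have "Poly_Mapping.update k v f = f + Poly_Mapping.single k v"
    using update(1) by (intro poly_mapping_eqI) (auto simp: lookup_update lookup_add lookup_single in_keys_iff when_def)
  then show ?case using assms update.IH by simp
qed

lemma fscal_mult_single: "fscal z * Poly_Mapping.single w v = Poly_Mapping.single w (z * v)"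
  by (simp add: fscal_def mult_single)

lemma fscal_commute: "fscal z * a = a * fscal z"
proof (induction a rule: poly_mapping_additive_induct)
  case (single w v) then show ?case by (simp add: fscal_def mult_single mult.commute)
qed (simp_all add: algebra_simps)

lemma fscal_1 [simp]: "fscal 1 = 1" and fscal_0 [simp]: "fscal 0 = 0"
  by (simp_all add: fscal_def)

lemma fscal_add: "fscal (y + z) = fscal y + fscal z"
  by (simp add: fscal_def single_add)

lemma fscal_mult: "fscal (y * z) = fscal y * fscal z"
  by (simp add: fscal_def mult_single)

lemma fscal_minus: "fscal (- z) = - fscal z"
  by (simp add: fscal_def single_uminus)

text \<open>Every word is reached from \<open>1\<close> by multiplying letters from the left. This is the principle by
  which properties stable under left multiplication are extended from the generators.\<close>

lemma free_alg_induct [case_names one letter scal add]: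
  assumes one: "P 1" and letter: "\<And>x a. P a \<Longrightarrow> P (flet x * a)"
    and scal: "\<And>z a. P a \<Longrightarrow> P (fscal z * a)" and add: "\<And>a b. P a \<Longrightarrow> P b \<Longrightarrow> P (a + b)"
  shows "P a"
proof (induction a rule: poly_mapping_additive_induct)
  case zero show ?case using scal[OF one, of 0] by simp
next
  case (single w v)
  have "P (Poly_Mapping.single (Word ls) 1)" for ls
  proof (induction ls)
    case Nil show ?case using one by (simp add: zero_word_def[symmetric])
  next
    case (Cons x ls)
    have "Poly_Mapping.single (Word (x # ls)) 1 = flet x * Poly_Mapping.single (Word ls) 1"
      by (simp add: flet_def mult_single)
    then show ?case using letter Cons by simp
  qed
  then show ?case using scal[of "Poly_Mapping.single w 1" v] by (cases w) (simp add: fscal_mult_single)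
qed (rule add)

text \<open>An assignment of operators to the letters extends to words by composition and to the free
  algebra by linearity.\<close>

fun word_act :: "(letter \<Rightarrow> complex poly \<Rightarrow> complex poly) \<Rightarrow> word \<Rightarrow> complex poly \<Rightarrow> complex poly" where
  "word_act f (Word ls) p = foldr f ls p"

definition alg_act :: "(letter \<Rightarrow> complex poly \<Rightarrow> complex poly) \<Rightarrow> free_alg \<Rightarrow> complex poly \<Rightarrow> complex poly" where
  "alg_act f a p = (\<Sum>w\<in>Poly_Mapping.keys a. Polynomial.smult (Poly_Mapping.lookup a w) (word_act f w p))"

lemma alg_act_add: "alg_act f (a + b) p = alg_act f a p + alg_act f b p"
proof -
  let ?g = "\<lambda>a w. Polynomial.smult (Poly_Mapping.lookup a w) (word_act f w p)"
  let ?K = "Poly_Mapping.keys a \<union> Poly_Mapping.keys b"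
  have *: "alg_act f c p = sum (?g c) ?K" if "Poly_Mapping.keys c \<subseteq> ?K" for c
    unfolding alg_act_def by (rule sum.mono_neutral_left) (use that in \<open>auto simp: in_keys_iff\<close>)
  have "alg_act f (a + b) p = sum (?g (a + b)) ?K" by (rule *) (rule keys_add)
  also have "\<dots> = sum (?g a) ?K + sum (?g b) ?K"
    by (simp add: lookup_add smult_add_left sum.distrib)
  finally show ?thesis using *[of a] *[of b] by simp
qed

lemma alg_act_single: "alg_act f (Poly_Mapping.single w v) p = Polynomial.smult v (word_act f w p)"
  by (simp add: alg_act_def)

lemma alg_act_0 [simp]: "alg_act f 0 p = 0"
  by (simp add: alg_act_def)

lemma alg_act_minus: "alg_act f (- a) p = - alg_act f a p"
  using alg_act_add[of f a "- a" p] by (simp add: eq_neg_iff_add_eq_0 add.commute)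

lemma alg_act_diff: "alg_act f (a - b) p = alg_act f a p - alg_act f b p"
  using alg_act_add[of f a "- b" p] by (simp add: alg_act_minus)

lemma alg_act_sum: "alg_act f (sum g A) p = (\<Sum>x\<in>A. alg_act f (g x) p)"
  by (induction A rule: infinite_finite_induct) (simp_all add: alg_act_add)

lemma alg_act_fscal: "alg_act f (fscal z) p = Polynomial.smult z p"
  by (simp add: fscal_def alg_act_single zero_word_def)

lemma alg_act_1 [simp]: "alg_act f 1 p = p"
  using alg_act_fscal[of f 1] by simp

lemma alg_act_flet: "alg_act f (flet x) p = f x p"
  by (simp add: flet_def alg_act_single)

locale letter_rep =
  fixes f :: "letter \<Rightarrow> complex poly \<Rightarrow> complex poly"
  assumes f_add: "f x (p + q) = f x p + f x q" and f_smult: "f x (Polynomial.smult z p) = Polynomial.smult z (f x p)"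
begin

lemma f_zero: "f x 0 = 0" using f_smult[of x 0 0] by simp

lemma word_act_add: "word_act f w (p + q) = word_act f w p + word_act f w q"
proof (cases w)
  case (Word ls) then show ?thesis by (induction ls arbitrary: w) (auto simp: f_add)
qed

lemma word_act_smult: "word_act f w (Polynomial.smult z p) = Polynomial.smult z (word_act f w p)"
proof (cases w)
  case (Word ls) then show ?thesis by (induction ls arbitrary: w) (auto simp: f_smult)
qed

lemma alg_act_add_right: "alg_act f a (p + q) = alg_act f a p + alg_act f a q"
  by (simp add: alg_act_def word_act_add smult_add_right sum.distrib)

lemma alg_act_smult_right: "alg_act f a (Polynomial.smult z p) = Polynomial.smult z (alg_act f a p)"
proof (induction a rule: poly_mapping_additive_induct)
  case (single w v) then show ?case by (simp add: alg_act_single word_act_smult mult.commute)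
qed (simp_all add: alg_act_add smult_add_right)

lemma alg_act_zero_right [simp]: "alg_act f a 0 = 0"
  using alg_act_smult_right[of a 0 0] by simp

lemma alg_act_minus_right: "alg_act f a (- p) = - alg_act f a p"
  using alg_act_smult_right[of a "- 1" p] by simp

lemma alg_act_diff_right: "alg_act f a (p - q) = alg_act f a p - alg_act f a q"
  using alg_act_add_right[of a p "- q"] by (simp add: alg_act_minus_right)

lemma alg_act_mult: "alg_act f (a * b) p = alg_act f a (alg_act f b p)"
proof -
  have scal_mult: "alg_act f (fscal z * b) p = Polynomial.smult z (alg_act f b p)" for z b p
  proof (induction b rule: poly_mapping_additive_induct)
    case (add a b) then show ?case by (simp add: distrib_left alg_act_add smult_add_right)
  qed (simp_all add: fscal_mult_single alg_act_single)
  have letter_mult: "alg_act f (flet x * b) p = f x (alg_act f b p)" for x b p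
  proof (induction b rule: poly_mapping_additive_induct)
    case zero then show ?case by (simp add: f_zero)
  next
    case (single w v)
    then show ?case by (cases w) (simp add: flet_def mult_single alg_act_single f_smult)
  next
    case (add a b) then show ?case by (simp add: distrib_left alg_act_add f_add)
  qed
  show ?thesis
  proof (induction a rule: free_alg_induct)
    case (letter x a) then show ?case by (simp only: mult.assoc letter_mult)
  next
    case (scal z a) then show ?case by (simp only: mult.assoc scal_mult)
  next
    case (add a b) then show ?case by (simp add: distrib_right alg_act_add)
  qed simp
qed

end

section \<open>The Dunkl representation on polynomials\<close>

text \<open>The Dunkl operator of a cyclic group lowers the degree by one; on \<open>x\<^sup>n\<close> its coefficient is \<open>\<mu> n\<close>.\<close>

lift_definition lowering :: "(nat \<Rightarrow> complex) \<Rightarrow> complex poly \<Rightarrow> complex poly"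
  is "\<lambda>\<mu> p n. \<mu> (Suc n) * p (Suc n)"
  by (auto elim: MOST_SucI[THEN MOST_mono])

lift_definition rescale :: "complex \<Rightarrow> complex poly \<Rightarrow> complex poly"
  is "\<lambda>z p n. z ^ n * p n"
  by (auto elim: MOST_mono)

lemma coeff_lowering [simp]: "coeff (lowering \<mu> p) n = \<mu> (Suc n) * coeff p (Suc n)"
  by (rule lowering.rep_eq[THEN fun_cong])

lemma coeff_rescale [simp]: "coeff (rescale z p) n = z ^ n * coeff p n"
  by (rule rescale.rep_eq[THEN fun_cong])

section \<open>The Cherednik algebra acts on polynomials\<close>

lemma ring_free_ring: "ring free_ring"
proof (rule ringI)
  show "abelian_group free_ring"
    by (rule abelian_groupI) (auto simp: free_ring_def algebra_simps intro: exI[of _ "- _"])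
  show "Group.monoid free_ring"
    by (rule monoidI) (auto simp: free_ring_def algebra_simps)
qed (auto simp: free_ring_def algebra_simps)

lemma free_ring_simps [simp]:
  "carrier free_ring = UNIV" "a \<otimes>\<^bsub>free_ring\<^esub> b = a * b" "a \<oplus>\<^bsub>free_ring\<^esub> b = a + b"
  "\<one>\<^bsub>free_ring\<^esub> = 1" "\<zero>\<^bsub>free_ring\<^esub> = 0"
  by (simp_all add: free_ring_def)

lemma a_inv_free_ring [simp]: "\<ominus>\<^bsub>free_ring\<^esub> a = - a"
proof -
  interpret ring free_ring by (rule ring_free_ring)
  show ?thesis by (rule minus_equality) auto
qed

lemma ideal_free_ringI:
  assumes "0 \<in> I" "\<And>a b. a \<in> I \<Longrightarrow> b \<in> I \<Longrightarrow> a + b \<in> I"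
    "\<And>a x. a \<in> I \<Longrightarrow> x * a \<in> I" "\<And>a x. a \<in> I \<Longrightarrow> a * x \<in> I"
  shows "ideal I free_ring"
proof (rule idealI[OF ring_free_ring])
  have "- a \<in> I" if "a \<in> I" for a using assms(3)[OF that, of "- 1"] by simp
  then have "inv\<^bsub>add_monoid free_ring\<^esub> a \<in> I" if "a \<in> I" for a
    using that a_inv_free_ring[of a] unfolding a_inv_def by simp
  then show "subgroup I (add_monoid free_ring)"
    using assms(1,2) by (intro subgroup.intro) auto
qed (use assms in auto)

text \<open>The candidate for the Verma module. The \<open>\<mu>\<^sub>n = n - b\<^sub>n\<close> come from moving \<open>y\<close> to the right
  through \<open>x\<^sup>n\<close>, where it kills \<open>1\<close>, and collecting the commutators.\<close>

fun dunkl :: "nat \<Rightarrow> complex \<Rightarrow> (nat \<Rightarrow> complex) \<Rightarrow> letter \<Rightarrow> complex poly \<Rightarrow> complex poly" where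
  "dunkl m l c LetX p = pCons 0 p"
| "dunkl m l c LetY p = lowering (\<lambda>n. of_nat n - bnum m l c n) p"
| "dunkl m l c (LetW j) p = rescale (l ^ j) p"

interpretation dunkl: letter_rep "dunkl m l c" for m l c
proof
  fix x p q z
  show "dunkl m l c x (p + q) = dunkl m l c x p + dunkl m l c x q"
    by (cases x) (auto intro!: poly_eqI simp: algebra_simps)
  show "dunkl m l c x (Polynomial.smult z p) = Polynomial.smult z (dunkl m l c x p)"
    by (cases x) (auto intro!: poly_eqI simp: algebra_simps)
qed

locale cyclic_cherednik =
  fixes m :: nat and l :: complex and c :: "nat \<Rightarrow> complex"
  assumes m_ge_2: "m \<ge> 2" and primitive: "primitive_root_of_unity m l"
begin

abbreviation "act \<equiv> alg_act (dunkl m l c)"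
abbreviation "rels \<equiv> cherednik_rels m l c"
abbreviation "H \<equiv> cherednik m l c"
abbreviation "cl \<equiv> hcl m l c"

definition \<mu> :: "nat \<Rightarrow> complex" where "\<mu> n = of_nat n - bnum m l c n"

lemma l_pow_m: "l ^ m = 1" and l_pow_neq_1: "0 < j \<Longrightarrow> j < m \<Longrightarrow> l ^ j \<noteq> 1"
  using primitive by (auto simp: primitive_root_of_unity_def)

lemma l_nonzero: "l \<noteq> 0"
  using l_pow_m m_ge_2 by (auto simp: power_0_left)

lemma l_pow_mod: "l ^ (j mod m) = l ^ j"
proof -
  have "l ^ j = l ^ (m * (j div m) + j mod m)" by simp
  also have "\<dots> = l ^ (j mod m)" by (simp only: power_add power_mult l_pow_m) simp
  finally show ?thesis by simp
qed

lemma bnum_0 [simp]: "bnum m l c 0 = 0"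
  by (simp add: bnum_def)

text \<open>In the Dunkl representation the commutator of \<open>y\<close> and \<open>x\<close> multiplies \<open>x\<^sup>n\<close> by \<open>\<mu>\<^sub>n\<^sub>+\<^sub>1 - \<mu>\<^sub>n\<close>, and the relation
  asks for \<open>1 - 2 \<Sum> c\<^sub>j \<lambda>\<^sup>j\<^sup>n\<close>; the quotients in \<open>b\<^sub>n\<close> are geometric sums that solve this recursion.\<close>

lemma bnum_Suc: "bnum m l c (Suc n) - bnum m l c n = 2 * (\<Sum>j=1..m-1. c j * l ^ (j * n))"
proof -
  have "(1 - l ^ (j * Suc n)) / (1 - l ^ j) * c j - (1 - l ^ (j * n)) / (1 - l ^ j) * c j = c j * l ^ (j * n)"
    if "j \<in> {1..m-1}" for j
  proof -
    have "0 < j" "j < m" using that by auto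
    then have "l ^ j \<noteq> 1" by (rule l_pow_neq_1)
    moreover have "(1 - q * z) / (1 - z) * d - (1 - q) / (1 - z) * d = d * q" if "z \<noteq> 1" for q z d :: complex
      using that by (simp add: divide_simps) (simp add: algebra_simps)
    moreover have "l ^ (j * Suc n) = l ^ (j * n) * l ^ j" by (simp add: power_add mult.commute)
    ultimately show ?thesis by simp
  qed
  then show ?thesis
    by (simp add: bnum_def right_diff_distrib[symmetric] sum_subtractf[symmetric] del: mult_Suc_right)
qed

lemma coeff_act:
  "coeff (act fx p) n = (case n of 0 \<Rightarrow> 0 | Suc k \<Rightarrow> coeff p k)"
  "coeff (act fy p) n = \<mu> (Suc n) * coeff p (Suc n)"
  "coeff (act (fw j) p) n = l ^ (j * n) * coeff p n"
  "coeff (act (fscal z) p) n = z * coeff p n"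
  by (simp_all add: alg_act_flet alg_act_fscal coeff_pCons \<mu>_def power_mult)

lemma act_rel: assumes "a \<in> rels" shows "act a p = 0"
proof -
  note simps = alg_act_diff dunkl.alg_act_mult coeff_act alg_act_sum
  consider j where "a = fw j - fw (j mod m)" | "a = fw 0 - 1"
    | i j where "a = fw i * fw j - fw (i + j)"
    | j where "a = fw j * fx - fscal (l ^ j) * fx * fw j"
    | j where "a = fw j * fy - fscal (inverse (l ^ j)) * fy * fw j"
    | "a = fy * fx - fx * fy - (1 - fscal 2 * (\<Sum>j=1..m-1. fscal (c j) * fw j))"
    using assms unfolding cherednik_rels_def by blast
  then have "coeff (act a p) n = 0" for n
  proof cases
    case 1 show ?thesis unfolding 1 by (simp add: simps power_mult l_pow_mod)
  next
    case 2 show ?thesis unfolding 2 by (simp add: simps)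
  next
    case 3 show ?thesis unfolding 3 by (simp add: simps power_add algebra_simps)
  next
    case 4 show ?thesis unfolding 4 by (cases n) (simp_all add: simps power_add)
  next
    case 5 show ?thesis using l_nonzero unfolding 5 by (simp add: simps power_add)
  next
    case 6
    define C where "C = fy * fx - fx * fy"
    have "coeff (act C p) n = (\<mu> (Suc n) - \<mu> n) * coeff p n"
      unfolding C_def by (cases n) (simp_all add: simps \<mu>_def algebra_simps)
    also have "\<mu> (Suc n) - \<mu> n = 1 - (bnum m l c (Suc n) - bnum m l c n)"
      by (simp add: \<mu>_def)
    finally have C: "coeff (act C p) n = (1 - 2 * (\<Sum>j=1..m-1. c j * l ^ (j * n))) * coeff p n"
      by (simp add: bnum_Suc)
    have "coeff (act a p) n = coeff (act C p) n - (coeff p n - 2 * (\<Sum>j=1..m-1. c j * (l ^ (j * n) * coeff p n)))"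
      unfolding 6 C_def[symmetric] by (simp add: simps coeff_sum)
    also have "\<dots> = 0"
      unfolding C by (simp add: left_diff_distrib sum_distrib_right mult.assoc)
    finally show ?thesis .
  qed
  then show ?thesis by (intro poly_eqI) simp
qed

definition "I = Idl\<^bsub>free_ring\<^esub> rels"

lemma ideal_I: "ideal I free_ring"
  unfolding I_def by (rule ring.genideal_ideal[OF ring_free_ring]) simp

lemma rels_in_I: "rels \<subseteq> I"
  unfolding I_def by (rule ring.genideal_self[OF ring_free_ring]) simp

lemma I_closed: "a \<in> I \<Longrightarrow> x * a \<in> I" "a \<in> I \<Longrightarrow> a * x \<in> I"
  using ideal.I_l_closed[OF ideal_I, of a x] ideal.I_r_closed[OF ideal_I, of a x] by simp_all

text \<open>The elements that act as zero form a two-sided ideal containing the relations, so the action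
  descends to the Cherednik algebra.\<close>

lemma act_I: assumes "a \<in> I" shows "act a p = 0"
proof -
  have "ideal {a. \<forall>p. act a p = 0} free_ring"
    by (rule ideal_free_ringI) (simp_all add: alg_act_add dunkl.alg_act_mult)
  then have "I \<subseteq> {a. \<forall>p. act a p = 0}"
    unfolding I_def by (rule ring.genideal_minimal[OF ring_free_ring]) (use act_rel in auto)
  then show ?thesis using assms by auto
qed

interpretation I: ideal I free_ring by (rule ideal_I)

lemma cl_eq: "cl a = I +>\<^bsub>free_ring\<^esub> a"
  by (simp add: hcl_def I_def)

lemma cl_eq_iff: "cl a = cl b \<longleftrightarrow> a - b \<in> I"
  using I.a_rcos_module[of b a] I.a_repr_independence'[of a b] I.a_rcos_self[of a]
  by (auto simp: cl_eq)

lemma carrier_H: "carrier H = range cl"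
  by (auto simp: cherednik_def I_def[symmetric] FactRing_def A_RCOSETS_defs a_r_coset_def cl_eq)

lemma H_simps: "cl a \<oplus>\<^bsub>H\<^esub> cl b = cl (a + b)" "cl a \<otimes>\<^bsub>H\<^esub> cl b = cl (a * b)" "\<one>\<^bsub>H\<^esub> = cl 1"
  using I.a_rcos_sum[of a b] I.rcoset_mult_add[of a b]
  by (simp_all add: cherednik_def I_def[symmetric] FactRing_def cl_eq)

lemma cl_in_H [simp]: "cl a \<in> carrier H"
  by (simp add: carrier_H)

lemma act_cong: "cl a = cl b \<Longrightarrow> act a p = act b p"
  using act_I[of "a - b" p] by (simp add: cl_eq_iff alg_act_diff)

text \<open>The representative is irrelevant by \<open>act_cong\<close>.\<close>

definition hact :: "free_alg set \<Rightarrow> complex poly \<Rightarrow> complex poly" where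
  "hact h = act (SOME a. cl a = h)"

lemma hact_cl: "hact (cl a) p = act a p"
  unfolding hact_def by (rule act_cong) (rule someI, rule refl)

text \<open>The constant \<open>1\<close> spans the trivial representation of the subalgebra generated by \<open>W\<close> and \<open>y\<close>;
  this makes the map from the tensor product to polynomials well defined.\<close>

lemma triv_act_hact: "triv_act m l c h s \<Longrightarrow> h \<in> carrier H \<and> hact h 1 = [:s:]"
proof (induction rule: triv_act.induct)
  case (add a s b t)
  then obtain u v where uv: "a = cl u" "b = cl v" by (auto simp: carrier_H)
  then show ?case using add.IH by (simp add: H_simps hact_cl alg_act_add)
next
  case (mul a s b t)
  then obtain u v where uv: "a = cl u" "b = cl v" by (auto simp: carrier_H)
  have "act u [:t:] = Polynomial.smult t (act u 1)"
    using dunkl.alg_act_smult_right[of m l c u t 1] by (simp add: one_pCons)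
  then show ?case using mul.IH uv
    by (simp add: H_simps hact_cl dunkl.alg_act_mult mult.commute)
next
  case (grp j)
  have "coeff (rescale (l ^ j) 1) n = coeff 1 n" for n by (cases n) auto
  then have "rescale (l ^ j) 1 = 1" by (rule poly_eqI)
  then show ?case by (simp add: hact_cl alg_act_flet one_pCons)
next
  case y
  have "act fy 1 = 0" by (rule poly_eqI) (simp add: coeff_act)
  then show ?case by (simp add: hact_cl)
qed (simp_all add: hact_cl alg_act_fscal one_pCons)

end

section \<open>The Verma module is the polynomial representation\<close>

text \<open>Extends a function additively to the free abelian group; \<open>frag_extend\<close> is the case in which the
  target is itself a free abelian group.\<close>

definition int_extend :: "('a \<Rightarrow> 'b::ring_1) \<Rightarrow> ('a \<Rightarrow>\<^sub>0 int) \<Rightarrow> 'b" where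
  "int_extend g t = (\<Sum>k\<in>Poly_Mapping.keys t. of_int (Poly_Mapping.lookup t k) * g k)"

lemma int_extend_add: "int_extend g (s + t) = int_extend g s + int_extend g t"
proof -
  let ?K = "Poly_Mapping.keys s \<union> Poly_Mapping.keys t"
  have *: "int_extend g u = (\<Sum>k\<in>?K. of_int (Poly_Mapping.lookup u k) * g k)" if "Poly_Mapping.keys u \<subseteq> ?K" for u
    unfolding int_extend_def by (rule sum.mono_neutral_left) (use that in \<open>auto simp: in_keys_iff\<close>)
  show ?thesis
    using *[of s] *[of t] *[of "s + t"] keys_add[of s t]
    by (simp add: lookup_add distrib_right sum.distrib)
qed

lemma int_extend_of [simp]: "int_extend g (frag_of k) = g k"
  by (simp add: int_extend_def)

lemma int_extend_0 [simp]: "int_extend g 0 = 0"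
  by (simp add: int_extend_def)

lemma int_extend_minus: "int_extend g (- t) = - int_extend g t"
  using int_extend_add[of g t "- t"] by (simp add: eq_neg_iff_add_eq_0 add.commute)

lemma int_extend_diff: "int_extend g (s - t) = int_extend g s - int_extend g t"
  using int_extend_add[of g s "- t"] by (simp add: int_extend_minus)

context cyclic_cherednik
begin

abbreviation "T \<equiv> tensor_free m l c"
abbreviation "null \<equiv> tensor_null m l c"

lemma T_simps [simp]: "t \<in> carrier T \<longleftrightarrow> Poly_Mapping.keys t \<subseteq> carrier H \<times> UNIV"
  "s \<oplus>\<^bsub>T\<^esub> t = s + t" "\<zero>\<^bsub>T\<^esub> = 0"
  by (auto simp: tensor_free_def)

lemma smult_T: "h \<odot>\<^bsub>T\<^esub> t = frag_extend (\<lambda>(k, z). frag_of (h \<otimes>\<^bsub>H\<^esub> k, z)) t"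
  by (simp add: tensor_free_def)

lemma operator_group_T: "operator_group H T"
proof (rule operator_group.intro)
  show "abelian_group T"
    by (rule abelian_groupI)
      (auto simp: algebra_simps dest!: subsetD[OF keys_add] intro: bexI[of _ "- _"])
  show "operator_group_axioms H T"
  proof
    fix h s t assume h: "h \<in> carrier H" and s: "s \<in> carrier T"
    then show "h \<odot>\<^bsub>T\<^esub> s \<in> carrier T"
      using keys_frag_extend[of "\<lambda>(k, z). frag_of (h \<otimes>\<^bsub>H\<^esub> k, z)" s]
      by (force simp: smult_T carrier_H H_simps)
    show "h \<odot>\<^bsub>T\<^esub> (s \<oplus>\<^bsub>T\<^esub> t) = h \<odot>\<^bsub>T\<^esub> s \<oplus>\<^bsub>T\<^esub> h \<odot>\<^bsub>T\<^esub> t"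
      by (simp add: smult_T frag_extend_add)
  qed
qed

interpretation T: operator_group H T by (rule operator_group_T)

lemma a_inv_T: assumes "t \<in> carrier T" shows "\<ominus>\<^bsub>T\<^esub> t = - t"
  using assms by (intro T.minus_equality) auto

abbreviation gen :: "free_alg \<Rightarrow> complex \<Rightarrow> (free_alg set \<times> complex) \<Rightarrow>\<^sub>0 int" where
  "gen a z \<equiv> frag_of (cl a, z)"

text \<open>Naming classes by representatives lets all computations with the tensor relations take place in
  the free algebra.\<close>

lemma tensor_rels_cases:
  "t \<in> tensor_rels m l c \<longleftrightarrow>
    (\<exists>a b z. t = gen (a + b) z - gen a z - gen b z) \<or>
    (\<exists>a z z'. t = gen a (z + z') - gen a z - gen a z') \<or>
    (\<exists>a b s z. t = gen (a * b) z - gen a (s * z) \<and> triv_act m l c (cl b) s)"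
proof -
  have 3: "(\<exists>h b s z. t = frag_of (h \<otimes>\<^bsub>H\<^esub> b, z) - frag_of (h, s * z) \<and> h \<in> carrier H \<and> triv_act m l c b s)
    \<longleftrightarrow> (\<exists>a b s z. t = gen (a * b) z - gen a (s * z) \<and> triv_act m l c (cl b) s)" (is "?L \<longleftrightarrow> ?R")
  proof
    assume ?L
    then obtain h b s z where *: "t = frag_of (h \<otimes>\<^bsub>H\<^esub> b, z) - frag_of (h, s * z)" "h \<in> carrier H" "triv_act m l c b s"
      by blast
    moreover obtain u v where "h = cl u" "b = cl v" using * triv_act_hact[of b s] by (auto simp: carrier_H)
    ultimately have "t = gen (u * v) z - gen u (s * z) \<and> triv_act m l c (cl v) s" by (simp add: H_simps)
    then show ?R by blast
  next
    assume ?R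
    then obtain a b s z where "t = gen (a * b) z - gen a (s * z)" "triv_act m l c (cl b) s" by blast
    then show ?L by (intro exI[of _ "cl a"] exI[of _ "cl b"] exI[of _ s] exI[of _ z]) (simp add: H_simps)
  qed
  have 1: "(\<exists>h k z. t = frag_of (h \<oplus>\<^bsub>H\<^esub> k, z) - frag_of (h, z) - frag_of (k, z) \<and> h \<in> carrier H \<and> k \<in> carrier H)
    \<longleftrightarrow> (\<exists>a b z. t = gen (a + b) z - gen a z - gen b z)"
    (is "?L \<longleftrightarrow> ?R")
  proof
    assume ?R
    then obtain a b z where "t = gen (a + b) z - gen a z - gen b z" by blast
    then show ?L by (intro exI[of _ "cl a"] exI[of _ "cl b"] exI[of _ z]) (simp add: H_simps)
  next
    assume ?L
    then obtain h k z where *: "t = frag_of (h \<oplus>\<^bsub>H\<^esub> k, z) - frag_of (h, z) - frag_of (k, z)"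
      "h \<in> carrier H" "k \<in> carrier H" by blast
    then obtain a b where "h = cl a" "k = cl b" by (auto simp: carrier_H)
    with * have "t = gen (a + b) z - gen a z - gen b z" by (simp add: H_simps)
    then show ?R by blast
  qed
  have 2: "(\<exists>h z z'. t = frag_of (h, z + z') - frag_of (h, z) - frag_of (h, z') \<and> h \<in> carrier H)
    \<longleftrightarrow> (\<exists>a z z'. t = gen a (z + z') - gen a z - gen a z')"
    by (auto simp: carrier_H)
  show ?thesis
    unfolding tensor_rels_def Let_def Un_iff mem_Collect_eq 1 2 3 by blast
qed

lemma keys_gen_subset: "Poly_Mapping.keys (gen a z) \<subseteq> carrier H \<times> UNIV"
  by simp

lemma tensor_rels_in_T: "tensor_rels m l c \<subseteq> carrier T"
proof
  fix t assume "t \<in> tensor_rels m l c"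
  then show "t \<in> carrier T"
    unfolding tensor_rels_cases T_simps
    by (elim disjE exE conjE; simp; intro order_trans[OF keys_diff] Un_least keys_gen_subset)
qed

lemma subgroup_null: "subgroup null (add_monoid T)"
  unfolding tensor_null_def using T.add.generate_is_subgroup[of "tensor_rels m l c"] tensor_rels_in_T by simp

lemma rel_in_null: "t \<in> tensor_rels m l c \<Longrightarrow> t \<in> null"
  unfolding tensor_null_def by (rule generate.incl)

lemma null_closed: "0 \<in> null" "s \<in> null \<Longrightarrow> t \<in> null \<Longrightarrow> s + t \<in> null" "s \<in> null \<Longrightarrow> - s \<in> null"
    "s \<in> null \<Longrightarrow> t \<in> null \<Longrightarrow> s - t \<in> null"
proof -
  interpret N: subgroup null "add_monoid T" by (rule subgroup_null)
  show 0: "0 \<in> null" "\<And>s t. s \<in> null \<Longrightarrow> t \<in> null \<Longrightarrow> s + t \<in> null"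
    using N.one_closed N.m_closed by auto
  show minus: "- s \<in> null" if "s \<in> null" for s
  proof -
    have "null \<subseteq> carrier T" using N.subset by simp
    then have "s \<in> carrier T" using that by (rule subsetD)
    then show ?thesis using N.m_inv_closed[OF that] a_inv_T[of s] by (simp add: a_inv_def)
  qed
  show "s \<in> null \<Longrightarrow> t \<in> null \<Longrightarrow> s - t \<in> null" using 0(2)[of s "- t"] minus[of t] by simp
qed

lemma smult_null: assumes "h \<in> carrier H" "t \<in> null" shows "h \<odot>\<^bsub>T\<^esub> t \<in> null"
proof -
  obtain d where d: "h = cl d" using assms(1) by (auto simp: carrier_H)
  have rel: "h \<odot>\<^bsub>T\<^esub> r \<in> null" if r: "r \<in> tensor_rels m l c" for r
  proof -
    have "h \<odot>\<^bsub>T\<^esub> r \<in> tensor_rels m l c"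
      using r unfolding tensor_rels_cases
    proof (elim disjE exE conjE, goal_cases)
      case (1 a b z)
      then have "h \<odot>\<^bsub>T\<^esub> r = gen (d * a + d * b) z - gen (d * a) z - gen (d * b) z"
        by (simp add: smult_T frag_extend_diff d H_simps distrib_left)
      then show ?case by blast
    next
      case (2 a z z')
      then have "h \<odot>\<^bsub>T\<^esub> r = gen (d * a) (z + z') - gen (d * a) z - gen (d * a) z'"
        by (simp add: smult_T frag_extend_diff d H_simps)
      then show ?case by blast
    next
      case (3 a b s z)
      then have "h \<odot>\<^bsub>T\<^esub> r = gen (d * a * b) z - gen (d * a) (s * z)"
        by (simp add: smult_T frag_extend_diff d H_simps mult.assoc)
      then show ?case using 3 by blast
    qed
    then show ?thesis by (rule rel_in_null)
  qed
  from assms(2)[unfolded tensor_null_def] show ?thesis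
  proof (induction rule: generate.induct)
    case one
    then show ?case using null_closed(1) by (simp add: smult_T)
  next
    case (incl r) then show ?case by (rule rel)
  next
    case (inv r)
    then have "inv\<^bsub>add_monoid T\<^esub> r = - r" using a_inv_T[of r] tensor_rels_in_T unfolding a_inv_def by blast
    then show ?case using rel[OF inv] null_closed(3) by (simp add: smult_T frag_extend_minus)
  next
    case (eng r s) then show ?case using null_closed(2) by (simp add: smult_T frag_extend_add)
  qed
qed

lemma submodule_null: "submodule null H T"
  by (rule submodule.intro[OF subgroup_null]) (unfold_locales, rule smult_null)

text \<open>The annihilator of \<open>1 \<otimes> 1\<close>, a left ideal of the free algebra.\<close>

definition ann :: "free_alg set" where "ann = {a. gen a 1 \<in> null}"

lemma gen_add: "gen (a + b) z - gen a z - gen b z \<in> null"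
  by (rule rel_in_null) (unfold tensor_rels_cases, blast)

lemma gen_triv: "triv_act m l c (cl b) s \<Longrightarrow> gen (a * b) z - gen a (s * z) \<in> null"
  by (rule rel_in_null) (unfold tensor_rels_cases, blast)

lemma gen_0: "gen 0 z \<in> null"
  using gen_add[of 0 0 z] null_closed(3) by fastforce

lemma ann_I: "a \<in> I \<Longrightarrow> a \<in> ann"
proof -
  assume "a \<in> I"
  then have "cl a = cl 0" by (simp add: cl_eq_iff)
  then show ?thesis using gen_0 by (simp add: ann_def)
qed

lemma gen_diff: "gen (a - b) z - (gen a z - gen b z) \<in> null"
  using gen_add[of "a - b" b z] null_closed(3) by (fastforce simp: algebra_simps)

lemma ann_add: "a \<in> ann \<Longrightarrow> b \<in> ann \<Longrightarrow> a + b \<in> ann"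
  using null_closed(2)[OF gen_add[of a b 1] null_closed(2)[of "gen a 1" "gen b 1"]] by (simp add: ann_def)

lemma ann_mult: assumes "a \<in> ann" shows "d * a \<in> ann"
  using smult_null[of "cl d" "gen a 1"] assms by (simp add: ann_def smult_T H_simps)

lemma ann_triv: assumes "triv_act m l c (cl b) s" shows "b - fscal s \<in> ann"
proof -
  have "gen b 1 - gen 1 s \<in> null" using gen_triv[OF assms, of 1 1] by simp
  moreover have "gen (fscal s) 1 - gen 1 s \<in> null" using gen_triv[OF triv_act.scal, of 1 s 1] by simp
  ultimately have "gen b 1 - gen (fscal s) 1 \<in> null" using null_closed(4) by fastforce
  from null_closed(2)[OF gen_diff[of b "fscal s" 1] this] show ?thesis by (simp add: ann_def)
qed

text \<open>The element \<open>p(x)\<close> of the free algebra.\<close>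

definition at_x :: "complex poly \<Rightarrow> free_alg" where
  "at_x p = (\<Sum>i\<le>degree p. fscal (coeff p i) * fx ^ i)"

lemma at_x_eq: "degree p \<le> n \<Longrightarrow> at_x p = (\<Sum>i\<le>n. fscal (coeff p i) * fx ^ i)"
  unfolding at_x_def by (rule sum.mono_neutral_left) (auto simp: coeff_eq_0)

lemma at_x_0 [simp]: "at_x 0 = 0"
  by (simp add: at_x_def)

lemma at_x_add: "at_x (p + q) = at_x p + at_x q"
proof -
  define n where "n = max (degree p) (degree q)"
  have "degree (p + q) \<le> n" unfolding n_def by (rule degree_add_le_max)
  then show ?thesis
    using at_x_eq[of p n] at_x_eq[of q n] at_x_eq[of "p + q" n]
    by (simp add: n_def fscal_add distrib_right sum.distrib)
qed

lemma at_x_smult: "at_x (Polynomial.smult z p) = fscal z * at_x p"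
  using at_x_eq[OF degree_smult_le[of z p]]
  by (simp add: at_x_def fscal_mult sum_distrib_left mult.assoc)

lemma fscal_left_commute: "a * (fscal z * b) = fscal z * (a * b)"
  by (metis fscal_commute mult.assoc)

lemma at_x_pCons: "at_x (pCons 0 p) = fx * at_x p"
proof -
  have "at_x (pCons 0 p) = (\<Sum>i\<le>Suc (degree p). fscal (coeff (pCons 0 p) i) * fx ^ i)"
    by (rule at_x_eq) (rule degree_pCons_le)
  also have "\<dots> = (\<Sum>i\<le>degree p. fscal (coeff p i) * (fx * fx ^ i))"
    by (subst sum.atMost_Suc_shift) simp
  also have "\<dots> = fx * at_x p"
    by (simp add: at_x_def sum_distrib_left fscal_left_commute)
  finally show ?thesis .
qed

lemma at_x_const: "at_x [:z:] = fscal z"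
  by (simp add: at_x_def)

lemma act_at_x: "act (at_x p) 1 = p"
proof (induction p)
  case (pCons a p)
  have "pCons a p = [:a:] + pCons 0 p" by simp
  then have "at_x (pCons a p) = fscal a + fx * at_x p" by (simp only: at_x_add at_x_const at_x_pCons)
  then show ?case
    using pCons by (simp add: alg_act_add dunkl.alg_act_mult alg_act_fscal alg_act_flet one_pCons)
qed simp

text \<open>\<open>a \<otimes> 1\<close> lies in the span of the \<open>x\<^sup>n \<otimes> 1\<close>. The following lemmas show that the elements with
  this property are stable under left multiplication by each letter, hence are everything.\<close>

definition spanned :: "free_alg \<Rightarrow> bool" where
  "spanned a \<longleftrightarrow> (\<exists>p. a - at_x p \<in> ann)"

lemma spanned_at_x: "spanned (at_x p)"
  unfolding spanned_def using gen_0[of 1] by (intro exI[of _ p]) (simp add: ann_def)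

lemma spanned_cong: assumes "spanned b" "a - b \<in> ann" shows "spanned a"
proof -
  obtain p where "b - at_x p \<in> ann" using assms(1) by (auto simp: spanned_def)
  from ann_add[OF assms(2) this] show ?thesis unfolding spanned_def by (intro exI[of _ p]) simp
qed

lemma spanned_add: assumes "spanned a" "spanned b" shows "spanned (a + b)"
proof -
  obtain p q where "a - at_x p \<in> ann" "b - at_x q \<in> ann" using assms by (auto simp: spanned_def)
  from ann_add[OF this] show ?thesis
    unfolding spanned_def by (intro exI[of _ "p + q"]) (simp add: at_x_add algebra_simps)
qed

lemma spanned_scal: assumes "spanned a" shows "spanned (fscal z * a)"
proof -
  obtain p where "a - at_x p \<in> ann" using assms by (auto simp: spanned_def)
  from ann_mult[OF this, of "fscal z"] show ?thesis
    unfolding spanned_def by (intro exI[of _ "Polynomial.smult z p"]) (simp add: at_x_smult right_diff_distrib)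
qed

lemma spanned_sum: "(\<And>i. i \<in> A \<Longrightarrow> spanned (g i)) \<Longrightarrow> spanned (sum g A)"
  using spanned_at_x[of 0] by (induction A rule: infinite_finite_induct) (auto intro: spanned_add)

lemma spanned_fx: assumes "spanned a" shows "spanned (fx * a)"
proof -
  obtain p where "a - at_x p \<in> ann" using assms by (auto simp: spanned_def)
  from ann_mult[OF this, of fx] show ?thesis
    unfolding spanned_def by (intro exI[of _ "pCons 0 p"]) (simp add: at_x_pCons right_diff_distrib)
qed

text \<open>By linearity it suffices to test a left factor on the powers of \<open>x\<close>.\<close>

lemma spanned_mult:
  assumes "\<And>n. spanned (d * fx ^ n)" and "spanned a" shows "spanned (d * a)"
proof -
  obtain p where p: "a - at_x p \<in> ann" using assms by (auto simp: spanned_def)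
  have "spanned (d * at_x p)"
    unfolding at_x_def sum_distrib_left fscal_left_commute
    by (intro spanned_sum spanned_scal assms(1))
  moreover have "d * a - d * at_x p \<in> ann" using ann_mult[OF p, of d] by (simp add: right_diff_distrib)
  ultimately show ?thesis by (rule spanned_cong)
qed

lemma rel_mult_ann: "a - b \<in> rels \<Longrightarrow> a * d - b * d \<in> ann"
  using rels_in_I I_closed(2)[of "a - b" d] ann_I by (auto simp: left_diff_distrib)

lemma spanned_1: "spanned 1"
  using spanned_at_x[of "[:1:]"] by (simp add: at_x_const)

text \<open>Push \<open>w\<close> to the right through the powers of \<open>x\<close> until it meets the lowest weight vector, which it
  fixes.\<close>

lemma spanned_fw: assumes "spanned a" shows "spanned (fw j * a)"
proof (rule spanned_mult[OF _ assms])
  fix n show "spanned (fw j * fx ^ n)"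
  proof (induction n)
    case 0
    have "fw j - fscal 1 \<in> ann" by (rule ann_triv) (rule triv_act.grp)
    then show ?case using spanned_cong[OF spanned_1] by simp
  next
    case (Suc n)
    have "fw j * fx - fscal (l ^ j) * fx * fw j \<in> rels" unfolding cherednik_rels_def by blast
    from rel_mult_ann[OF this, of "fx ^ n"] have *: "fw j * fx ^ Suc n - fscal (l ^ j) * (fx * (fw j * fx ^ n)) \<in> ann"
      by (simp add: mult.assoc)
    show ?case by (rule spanned_cong[OF _ *]) (intro spanned_scal spanned_fx Suc)
  qed
qed

text \<open>Likewise for \<open>y\<close>, which kills the lowest weight vector; each exchange with \<open>x\<close> leaves a
  commutator in \<open>\<complex>W\<close>, dealt with by \<open>spanned_fw\<close>.\<close>

lemma spanned_fy: assumes "spanned a" shows "spanned (fy * a)"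
proof (rule spanned_mult[OF _ assms])
  fix n show "spanned (fy * fx ^ n)"
  proof (induction n)
    case 0
    have "fy - fscal 0 \<in> ann" by (rule ann_triv) (rule triv_act.y)
    then show ?case using spanned_cong[OF spanned_at_x[of 0]] by simp
  next
    case (Suc n)
    define S where "S = (\<Sum>j=1..m-1. fscal (c j) * fw j)"
    have "fy * fx - (fx * fy + (1 + fscal (- 2) * S)) \<in> rels"
      unfolding cherednik_rels_def S_def by (simp add: fscal_minus algebra_simps)
    from rel_mult_ann[OF this, of "fx ^ n"]
    have *: "fy * fx ^ Suc n - (fx * (fy * fx ^ n) + (fx ^ n + fscal (- 2) * (S * fx ^ n))) \<in> ann"
      by (simp add: distrib_right mult.assoc)
    have xn: "spanned (fx ^ n)" for n
      by (induction n) (auto intro: spanned_fx spanned_1)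
    have "spanned (S * fx ^ n)"
      unfolding S_def sum_distrib_right mult.assoc
      by (intro spanned_sum spanned_scal spanned_fw xn)
    then show ?case
      by (intro spanned_cong[OF _ *] spanned_add[OF spanned_fx[OF Suc] spanned_add[OF xn]] spanned_scal)
  qed
qed

lemma spanned: "spanned a"
proof (induction a rule: free_alg_induct)
  case (letter x a) then show ?case by (cases x) (simp_all add: spanned_fx spanned_fy spanned_fw)
qed (simp_all add: spanned_1 spanned_scal spanned_add)

text \<open>\<open>h \<otimes> z\<close> is sent to \<open>z \<sqdot> h(1)\<close>, computed in the polynomial representation.\<close>

definition val :: "((free_alg set \<times> complex) \<Rightarrow>\<^sub>0 int) \<Rightarrow> complex poly" where
  "val = int_extend (\<lambda>(h, z). Polynomial.smult z (hact h 1))"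

lemma val_add: "val (s + t) = val s + val t" and val_diff: "val (s - t) = val s - val t"
  and val_0 [simp]: "val 0 = 0" and val_minus: "val (- t) = - val t"
  by (simp_all add: val_def int_extend_add int_extend_diff int_extend_minus)

lemma val_gen: "val (gen a z) = Polynomial.smult z (act a 1)"
  by (simp add: val_def hact_cl)

lemma val_rel: assumes "t \<in> tensor_rels m l c" shows "val t = 0"
proof -
  have "act (a * b) 1 = Polynomial.smult s (act a 1)" if "triv_act m l c (cl b) s" for a b s
    using triv_act_hact[OF that] dunkl.alg_act_smult_right[of m l c a s 1]
    by (simp add: hact_cl dunkl.alg_act_mult one_pCons)
  then show ?thesis
    using assms unfolding tensor_rels_cases
    by (auto simp: val_diff val_gen alg_act_add smult_add_left smult_add_right mult.commute)
qed

lemma val_null: assumes "t \<in> null" shows "val t = 0"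
  using assms unfolding tensor_null_def
proof (induction rule: generate.induct)
  case (inv r)
  then have "inv\<^bsub>add_monoid T\<^esub> r = - r" using a_inv_T[of r] tensor_rels_in_T unfolding a_inv_def by blast
  then show ?case using val_rel[OF inv] by (simp add: val_minus)
qed (simp_all add: val_rel val_add)

text \<open>Modulo the tensor relations an element is \<open>p(x) \<otimes> 1\<close> for some polynomial \<open>p\<close>, and then its value is
  \<open>p\<close>. So spanning by the powers of \<open>x\<close> on one side and their independence in the polynomial
  representation on the other give injectivity.\<close>

lemma null_iff_val: assumes "t \<in> carrier T" shows "t \<in> null \<longleftrightarrow> val t = 0"
proof
  assume 0: "val t = 0"
  have "\<exists>a. t - gen a 1 \<in> null"
    using assms[unfolded T_simps]
  proof (induction t rule: frag_induction)
    case zero show ?case using null_closed(3)[OF gen_0[of 1]] by (intro exI[of _ 0]) simp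
  next
    case (one k)
    then obtain a z where "k = (cl a, z)" by (auto simp: carrier_H)
    moreover have "gen (a * fscal z) 1 - gen a (z * 1) \<in> null" by (rule gen_triv) (rule triv_act.scal)
    from null_closed(3)[OF this] have "gen a z - gen (a * fscal z) 1 \<in> null" by simp
    ultimately show ?case by blast
  next
    case (diff s t)
    then obtain a b where "s - gen a 1 \<in> null" "t - gen b 1 \<in> null" by blast
    from null_closed(4)[OF null_closed(4)[OF this] gen_diff[of a b 1]] show ?case
      by (intro exI[of _ "a - b"]) (simp add: algebra_simps)
  qed
  then obtain a where a: "t - gen a 1 \<in> null" ..
  obtain p where p: "a - at_x p \<in> ann" using spanned[of a] by (auto simp: spanned_def)
  have "act a 1 = 0" using val_null[OF a] 0 by (simp add: val_diff val_gen)
  moreover have "act (a - at_x p) 1 = 0"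
    using val_null[of "gen (a - at_x p) 1"] p by (simp add: ann_def val_gen)
  ultimately have "p = 0" by (simp add: alg_act_diff act_at_x)
  then have "gen a 1 \<in> null" using p by (simp add: ann_def)
  from null_closed(2)[OF a this] show "t \<in> null" by simp
qed (rule val_null)

lemma val_smult: assumes "t \<in> carrier T" shows "val (cl d \<odot>\<^bsub>T\<^esub> t) = act d (val t)"
  using assms[unfolded T_simps]
proof (induction t rule: frag_induction)
  case (one k)
  then obtain a z where "k = (cl a, z)" by (auto simp: carrier_H)
  then show ?case
    by (simp add: smult_T H_simps val_gen dunkl.alg_act_mult dunkl.alg_act_smult_right)
qed (simp_all add: smult_T frag_extend_diff val_diff dunkl.alg_act_diff_right)

abbreviation "V \<equiv> verma m l c"

text \<open>The isomorphism from the Verma module to polynomials. By \<open>\<Phi>_coset\<close> the choice of the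
  representative does not matter.\<close>

definition \<Phi> :: "verma_elt \<Rightarrow> complex poly" where "\<Phi> U = val (SOME t. t \<in> U)"

lemma \<Phi>_coset: assumes t: "t \<in> carrier T" shows "\<Phi> (null +>\<^bsub>T\<^esub> t) = val t"
proof -
  interpret N: abelian_subgroup null T by (rule T.submodule_abelian_subgroup[OF submodule_null])
  have "(SOME u. u \<in> null +>\<^bsub>T\<^esub> t) \<in> null +>\<^bsub>T\<^esub> t" (is "?u \<in> _")
    by (rule someI) (rule N.a_rcos_self[OF t])
  note u = this
  have uc: "?u \<in> carrier T" by (rule N.a_elemrcos_carrier[OF t u])
  have "?u \<oplus>\<^bsub>T\<^esub> \<ominus>\<^bsub>T\<^esub> t \<in> null" using N.a_rcos_module[OF t uc] u by blast
  then have "?u - t \<in> null" using a_inv_T[OF t] by simp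
  then show ?thesis using val_null[of "?u - t"] by (simp add: \<Phi>_def val_diff)
qed

lemma V_quot: "V = quot_module T null"
  by (simp add: verma_def)

lemma operator_group_V: "operator_group H V"
  unfolding V_quot by (rule T.quot_operator_group[OF submodule_null])

lemma carrier_V: "carrier V = (\<lambda>t. null +>\<^bsub>T\<^esub> t) ` carrier T"
  unfolding V_quot by (rule T.carrier_quot[OF submodule_null])

lemma \<Phi>_add: "u \<in> carrier V \<Longrightarrow> v \<in> carrier V \<Longrightarrow> \<Phi> (u \<oplus>\<^bsub>V\<^esub> v) = \<Phi> u + \<Phi> v"
  unfolding carrier_V unfolding V_quot
  using T.add_quot[OF submodule_null] \<Phi>_coset T.a_closed val_add T_simps(2) by fastforce

lemma \<Phi>_smult: "u \<in> carrier V \<Longrightarrow> \<Phi> (cl a \<odot>\<^bsub>V\<^esub> u) = act a (\<Phi> u)"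
  unfolding carrier_V unfolding V_quot
  using T.smult_quot[OF submodule_null cl_in_H] \<Phi>_coset T.smult_closed[OF cl_in_H] val_smult by fastforce

lemma \<Phi>_one: "\<Phi> (verma_one m l c) = 1" and verma_one_in_V: "verma_one m l c \<in> carrier V"
  unfolding verma_one_def H_simps carrier_V by (subst \<Phi>_coset) (simp_all add: val_gen)

lemma \<Phi>_bij: "bij_betw \<Phi> (carrier V) UNIV"
proof (rule bij_betwI')
  fix u v assume "u \<in> carrier V" "v \<in> carrier V"
  then obtain s t where st: "s \<in> carrier T" "t \<in> carrier T" "u = null +>\<^bsub>T\<^esub> s" "v = null +>\<^bsub>T\<^esub> t"
    unfolding carrier_V by blast
  have d: "s \<ominus>\<^bsub>T\<^esub> t = s - t" using st(2) a_inv_T[of t] by (simp add: a_minus_def)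
  then have "s - t \<in> carrier T" using T.minus_closed[OF st(1,2)] by simp
  then show "\<Phi> u = \<Phi> v \<longleftrightarrow> u = v"
    unfolding st(3,4) \<Phi>_coset[OF st(1)] \<Phi>_coset[OF st(2)] T.coset_eq_iff[OF submodule_null st(1,2)] d
    by (simp add: null_iff_val val_diff)
next
  fix p
  have "gen (at_x p) 1 \<in> carrier T" by simp
  moreover from this have "\<Phi> (null +>\<^bsub>T\<^esub> gen (at_x p) 1) = p" by (simp add: \<Phi>_coset val_gen act_at_x)
  ultimately show "\<exists>v\<in>carrier V. p = \<Phi> v" unfolding carrier_V by (metis imageI)
qed simp

end

section \<open>The radical\<close>

context cyclic_cherednik
begin

interpretation V: operator_group H V by (rule operator_group_V)

text \<open>The value \<open>(x\<^sup>n, x\<^sup>n)\<close> of the contravariant form.\<close>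

definition gram :: "nat \<Rightarrow> complex" where "gram n = (\<Prod>k=1..n. \<mu> k)"

lemma gram_0 [simp]: "gram 0 = 1" and gram_Suc: "gram (Suc n) = gram n * \<mu> (Suc n)"
  by (simp_all add: gram_def)

text \<open>The kernel of the form, described by coefficients.\<close>

definition Rad :: "complex poly set" where "Rad = {p. \<forall>n. gram n * coeff p n = 0}"

definition invariant :: "complex poly set \<Rightarrow> bool" where
  "invariant P \<longleftrightarrow> 0 \<in> P \<and> (\<forall>p\<in>P. \<forall>q\<in>P. p + q \<in> P) \<and> (\<forall>a. \<forall>p\<in>P. act a p \<in> P)"

lemma invariantD:
  assumes "invariant P" "p \<in> P"
  shows "q \<in> P \<Longrightarrow> p + q \<in> P" "act a p \<in> P" "Polynomial.smult z p \<in> P"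
  using assms alg_act_fscal[of "dunkl m l c" z p] unfolding invariant_def by metis+

lemma \<Phi>_zero: "\<Phi> \<zero>\<^bsub>V\<^esub> = 0"
  using \<Phi>_add[of "\<zero>\<^bsub>V\<^esub>" "\<zero>\<^bsub>V\<^esub>"] by simp

lemma \<Phi>_minus: "u \<in> carrier V \<Longrightarrow> \<Phi> (\<ominus>\<^bsub>V\<^esub> u) = - \<Phi> u"
  using \<Phi>_add[of "\<ominus>\<^bsub>V\<^esub> u" u] by (simp add: V.l_neg \<Phi>_zero eq_neg_iff_add_eq_0)

lemma invariant_image: assumes "submodule N H V" shows "invariant (\<Phi> ` N)"
proof -
  note D = V.submoduleD[OF assms]
  have N: "v \<in> carrier V" if "v \<in> N" for v using that D(1) by blast
  show ?thesis unfolding invariant_def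
  proof (intro conjI ballI allI)
    show "0 \<in> \<Phi> ` N" using D(2) \<Phi>_zero by (metis imageI)
  next
    fix p q assume "p \<in> \<Phi> ` N" "q \<in> \<Phi> ` N"
    then obtain u v where "u \<in> N" "p = \<Phi> u" "v \<in> N" "q = \<Phi> v" by blast
    then show "p + q \<in> \<Phi> ` N" using D(4)[of u v] \<Phi>_add[OF N N, of u v] by (metis imageI)
  next
    fix a p assume "p \<in> \<Phi> ` N"
    then obtain u where "u \<in> N" "p = \<Phi> u" by blast
    then show "act a p \<in> \<Phi> ` N" using D(5)[OF cl_in_H, of u a] \<Phi>_smult[OF N, of u a] by (metis imageI)
  qed
qed

lemma submodule_vimage: assumes "invariant P" shows "submodule {v \<in> carrier V. \<Phi> v \<in> P} H V"
proof (rule V.submoduleI)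
  note D = invariantD[OF assms]
  show "\<zero>\<^bsub>V\<^esub> \<in> {v \<in> carrier V. \<Phi> v \<in> P}"
    using assms by (simp add: \<Phi>_zero invariant_def)
  fix u assume u: "u \<in> {v \<in> carrier V. \<Phi> v \<in> P}"
  show "\<ominus>\<^bsub>V\<^esub> u \<in> {v \<in> carrier V. \<Phi> v \<in> P}"
    using u D(3)[of "\<Phi> u" "- 1"] by (simp add: \<Phi>_minus)
  show "u \<oplus>\<^bsub>V\<^esub> v \<in> {v \<in> carrier V. \<Phi> v \<in> P}" if "v \<in> {v \<in> carrier V. \<Phi> v \<in> P}" for v
    using u that D(1)[of "\<Phi> u" "\<Phi> v"] by (simp add: \<Phi>_add)
  show "r \<odot>\<^bsub>V\<^esub> u \<in> {v \<in> carrier V. \<Phi> v \<in> P}" if "r \<in> carrier H" for r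
  proof -
    obtain a where "r = cl a" using \<open>r \<in> carrier H\<close> by (auto simp: carrier_H)
    then show ?thesis using u V.smult_closed[OF that, of u] by (simp add: \<Phi>_smult D(2))
  qed
qed auto

text \<open>The index set \<open>{n. gram n = 0}\<close> is closed under successors, and \<open>y\<close> carries the factor \<open>\<mu>\<^sub>n\<^sub>+\<^sub>1\<close> that
  turns \<open>gram n\<close> into \<open>gram (n + 1)\<close>.\<close>

lemma act_letter_Rad: assumes "p \<in> Rad" shows "act (flet x) p \<in> Rad"
proof (cases x)
  case LetX
  have "gram n * coeff (act fx p) n = 0" for n
    using assms by (cases n) (auto simp: Rad_def coeff_act gram_Suc)
  then show ?thesis by (simp add: Rad_def LetX)
next
  case LetY
  have "gram n * coeff (act fy p) n = gram (Suc n) * coeff p (Suc n)" for n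
    by (simp add: coeff_act gram_Suc)
  then show ?thesis using assms by (simp add: Rad_def LetY del: mult_eq_0_iff)
next
  case (LetW j)
  then show ?thesis using assms by (auto simp: Rad_def coeff_act)
qed

lemma Rad_add: "p \<in> Rad \<Longrightarrow> q \<in> Rad \<Longrightarrow> p + q \<in> Rad"
  by (simp add: Rad_def distrib_left del: mult_eq_0_iff)

lemma invariant_Rad: "invariant Rad"
proof -
  have "act a p \<in> Rad" if p: "p \<in> Rad" for a p
  proof (induction a rule: free_alg_induct)
    case (letter x a) then show ?case by (simp add: dunkl.alg_act_mult act_letter_Rad)
  next
    case (scal z a) then show ?case by (auto simp: dunkl.alg_act_mult alg_act_fscal Rad_def)
  next
    case (add a b) then show ?case by (simp add: alg_act_add Rad_add)
  qed (simp add: p)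
  then show ?thesis by (simp add: invariant_def Rad_add) (simp add: Rad_def)
qed

text \<open>The group algebra part is chosen to act on \<open>x\<^sup>n\<close> by \<open>b\<^sub>n\<close>, which compensates the defect of
  \<open>x y\<close>, acting by \<open>n - b\<^sub>n\<close>.\<close>

definition euler :: free_alg where
  "euler = fx * fy + (\<Sum>j=1..m-1. fscal (2 * c j / (1 - l ^ j)) * (1 - fw j))"

lemma coeff_euler: "coeff (act euler p) n = of_nat n * coeff p n"
proof -
  have "coeff (act (fx * fy) p) n = \<mu> n * coeff p n"
    by (cases n) (simp_all add: dunkl.alg_act_mult coeff_act \<mu>_def)
  moreover have "coeff (act (\<Sum>j=1..m-1. fscal (2 * c j / (1 - l ^ j)) * (1 - fw j)) p) n = bnum m l c n * coeff p n"
    by (simp add: alg_act_sum dunkl.alg_act_mult coeff_sum coeff_act alg_act_diff bnum_def sum_distrib_left sum_distrib_right)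
      (rule sum.cong[OF refl], simp add: algebra_simps diff_divide_distrib)
  ultimately show ?thesis by (simp add: euler_def alg_act_add \<mu>_def algebra_simps)
qed

text \<open>Since \<open>euler\<close> has distinct eigenvalues on the powers of \<open>x\<close>, the operator \<open>euler - d\<close> removes the
  leading term of a polynomial of degree \<open>d\<close> and only rescales the constant term.\<close>

lemma constant_term_in_invariant:
  assumes P: "invariant P" and "p \<in> P" shows "[:coeff p 0:] \<in> P"
  using assms(2)
proof (induction "degree p" arbitrary: p rule: less_induct)
  case (less p)
  show ?case
  proof (cases "degree p = 0")
    case True
    then show ?thesis using less.prems by (metis degree_0_id)
  next
    case False
    define d where "d = degree p"
    define q where "q = act (euler - fscal (of_nat d)) p"
    have q: "coeff q n = (of_nat n - of_nat d) * coeff p n" for n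
      by (simp add: q_def alg_act_diff alg_act_fscal coeff_euler left_diff_distrib)
    have "degree q \<le> d - 1"
    proof (rule degree_le, intro allI impI)
      fix i assume "d - 1 < i"
      then consider "i = d" | "d < i" by linarith
      then show "coeff q i = 0" by cases (auto simp: q d_def coeff_eq_0)
    qed
    then have "degree q < degree p" using False d_def by simp
    moreover have "q \<in> P" unfolding q_def by (rule invariantD[OF P less.prems])
    ultimately have "[:coeff q 0:] \<in> P" by (rule less.hyps)
    \<comment> \<open>The constant term of \<open>q\<close> is \<open>- d\<close> times that of \<open>p\<close>.\<close>
    then have "Polynomial.smult (- 1 / of_nat d) [:coeff q 0:] \<in> P" by (rule invariantD[OF P])
    then show ?thesis using False by (simp add: q d_def)
  qed
qed

lemma coeff_fy_power: "gram k * coeff (act (fy ^ n) p) k = gram (n + k) * coeff p (n + k)"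
proof (induction n arbitrary: k)
  case (Suc n)
  have "gram k * coeff (act (fy ^ Suc n) p) k = gram (Suc k) * coeff (act (fy ^ n) p) (Suc k)"
    by (simp add: dunkl.alg_act_mult coeff_act gram_Suc)
  then show ?case using Suc[of "Suc k"] by simp
qed simp

text \<open>If \<open>p\<close> has a coefficient at \<open>x\<^sup>n\<close> with \<open>gram n \<noteq> 0\<close>, then \<open>y\<^sup>n p\<close> has a nonzero constant term, and
  that constant generates everything.\<close>

lemma invariant_proper_iff: assumes P: "invariant P" shows "P \<noteq> UNIV \<longleftrightarrow> P \<subseteq> Rad"
proof
  assume "P \<subseteq> Rad"
  moreover have "1 \<notin> Rad" by (auto simp: Rad_def intro!: exI[of _ 0])
  ultimately show "P \<noteq> UNIV" by blast
next
  assume neq: "P \<noteq> UNIV"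
  show "P \<subseteq> Rad"
  proof (rule ccontr)
    assume "\<not> P \<subseteq> Rad"
    then obtain p n where p: "p \<in> P" "gram n * coeff p n \<noteq> 0" by (auto simp: Rad_def)
    define z where "z = coeff (act (fy ^ n) p) 0"
    have z: "z \<noteq> 0" using coeff_fy_power[of 0 n p] p(2) by (simp add: z_def)
    have "[:z:] \<in> P" unfolding z_def by (intro constant_term_in_invariant[OF P] invariantD[OF P] p)
    from invariantD(3)[OF P this, of "1 / z"] have "1 \<in> P" using z by (simp add: one_pCons)
    from invariantD(2)[OF P this] have "q \<in> P" for q using act_at_x[of q] by metis
    then show False using neq by blast
  qed
qed

lemma submodule_proper_iff: assumes "submodule N H V" shows "N \<noteq> carrier V \<longleftrightarrow> \<Phi> ` N \<subseteq> Rad"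
proof -
  have "N \<subseteq> carrier V" by (rule V.submoduleD[OF assms])
  then have "N = carrier V \<longleftrightarrow> \<Phi> ` N = \<Phi> ` carrier V"
    using bij_betw_imp_inj_on[OF \<Phi>_bij] by (simp add: inj_on_image_eq_iff)
  then show ?thesis
    using invariant_proper_iff[OF invariant_image[OF assms]] bij_betw_imp_surj_on[OF \<Phi>_bij] by simp
qed

text \<open>The kernel of the form contains every proper submodule, so it is the only maximal one.\<close>

lemma verma_rad_eq: "verma_rad m l c = {v \<in> carrier V. \<Phi> v \<in> Rad}" (is "_ = ?R")
  unfolding verma_rad_def
proof (rule the_equality)
  have R: "submodule ?R H V" by (rule submodule_vimage[OF invariant_Rad])
  have proper: "?R \<noteq> carrier V" by (subst submodule_proper_iff[OF R]) auto
  have max: "N \<noteq> carrier V \<longleftrightarrow> N \<subseteq> ?R" if "submodule N H V" for N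
    using submodule_proper_iff[OF that] V.submoduleD(1)[OF that] by auto
  show "submodule ?R H V \<and> irreducible_module H (quot_module V ?R)"
    unfolding V.irreducible_quot_iff_maximal[OF R] using R proper max by blast
  fix N assume N: "submodule N H V \<and> irreducible_module H (quot_module V N)"
  then have "N \<noteq> carrier V" "?R = N \<or> ?R = carrier V"
    using V.irreducible_quot_iff_maximal[of N] max[of N] R by blast+
  then show "N = ?R" using proper by blast
qed

section \<open>The contravariant form\<close>

text \<open>The contravariant form transported to polynomials. The finite sum runs over the degree of the
  second argument, but by \<open>shapovalov_eq\<close> any bound for either degree serves.\<close>

definition shapovalov :: "complex poly \<Rightarrow> complex poly \<Rightarrow> complex" where
  "shapovalov p q = (\<Sum>n\<le>degree q. gram n * coeff p n * cnj (coeff q n))"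

lemma shapovalov_eq: "degree p \<le> N \<or> degree q \<le> N \<Longrightarrow> shapovalov p q = (\<Sum>n\<le>N. gram n * coeff p n * cnj (coeff q n))"
  unfolding shapovalov_def
  by (rule sum.mono_neutral_cong) (auto simp: coeff_eq_0)

lemma shapovalov_add: "shapovalov (p + q) r = shapovalov p r + shapovalov q r"
  by (simp add: shapovalov_def distrib_left distrib_right sum.distrib)

lemma shapovalov_smult: "shapovalov (Polynomial.smult z p) r = z * shapovalov p r"
  by (simp add: shapovalov_def sum_distrib_left algebra_simps)

lemma shapovalov_fy: "shapovalov (act fy p) q = shapovalov p (act fx q)"
proof -
  have "shapovalov p (act fx q) = (\<Sum>n\<le>Suc (degree q). gram n * coeff p n * cnj (coeff (act fx q) n))"
    by (rule shapovalov_eq) (simp add: alg_act_flet degree_pCons_le)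
  also have "\<dots> = (\<Sum>n\<le>degree q. gram (Suc n) * coeff p (Suc n) * cnj (coeff q n))"
    by (subst sum.atMost_Suc_shift) (simp add: coeff_act)
  finally show ?thesis by (simp add: shapovalov_def coeff_act gram_Suc mult.assoc)
qed

lemma shapovalov_Rad: "p \<in> Rad \<Longrightarrow> shapovalov p q = 0"
  unfolding shapovalov_def Rad_def by (rule sum.neutral) (metis (mono_tags, lifting) mem_Collect_eq mult_zero_left)

lemma norm_l: "norm l = 1"
proof -
  have "norm l ^ m = 1 ^ m" using l_pow_m by (metis norm_one norm_power power_one)
  then show ?thesis using m_ge_2 power_eq_imp_eq_base[of "norm l" m 1] by simp
qed

lemma shapovalov_fw: "shapovalov (act (fw j) p) (act (fw j) q) = shapovalov p q"
proof -
  have deg: "degree (act (fw j) q) \<le> degree q" by (rule degree_le) (simp add: coeff_act coeff_eq_0)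
  have "gram n * (l ^ (j * n) * a) * cnj (l ^ (j * n) * b) = gram n * a * cnj b" for n a b
  proof -
    have "gram n * (l ^ (j * n) * a) * cnj (l ^ (j * n) * b)
        = (l ^ (j * n) * cnj (l ^ (j * n))) * (gram n * a * cnj b)"
      by (simp only: complex_cnj_mult mult_ac)
    also have "l ^ (j * n) * cnj (l ^ (j * n)) = 1"
      using complex_norm_square[of "l ^ (j * n)"] by (simp add: norm_power norm_l)
    finally show ?thesis by simp
  qed
  then show ?thesis
    unfolding shapovalov_eq[OF disjI2[OF deg]] shapovalov_eq[OF disjI2[OF order_refl[of "degree q"]]] coeff_act
    by (intro sum.cong refl)
qed

text \<open>\<open>(p, 1)\<close> is the constant term of \<open>p\<close>, because \<open>(x q, 1)\<close> is conjugate to \<open>(1, x q) = (y 1, q) = 0\<close>.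
  Moving the powers of \<open>x\<close> from the second argument to powers of \<open>y\<close> on the first then determines
  all \<open>(p, x\<^sup>n)\<close>.\<close>

lemma contravariant_form_unique:
  assumes "contravariant_form m l c B" and u: "u \<in> carrier V" and v: "v \<in> carrier V"
  shows "B u v = shapovalov (\<Phi> u) (\<Phi> v)"
proof -
  define \<beta> where "\<beta> p q = B (inv_into (carrier V) \<Phi> p) (inv_into (carrier V) \<Phi> q)" for p q
  let ?\<Psi> = "inv_into (carrier V) \<Phi>"
  have \<Psi>: "?\<Psi> p \<in> carrier V" "\<Phi> (?\<Psi> p) = p" for p
    using bij_betw_imp_surj_on[OF \<Phi>_bij] by (auto intro: inv_into_into f_inv_into_f)
  have \<Psi>\<Phi>: "?\<Psi> (\<Phi> w) = w" if "w \<in> carrier V" for w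
    by (rule inv_into_f_f[OF bij_betw_imp_inj_on[OF \<Phi>_bij] that])
  have \<Psi>_add: "?\<Psi> (p + q) = ?\<Psi> p \<oplus>\<^bsub>V\<^esub> ?\<Psi> q" for p q
    using \<Psi>\<Phi>[of "?\<Psi> p \<oplus>\<^bsub>V\<^esub> ?\<Psi> q"] by (simp add: \<Phi>_add \<Psi>)
  have \<Psi>_act: "?\<Psi> (act a p) = cl a \<odot>\<^bsub>V\<^esub> ?\<Psi> p" for a p
    using \<Psi>\<Phi>[of "cl a \<odot>\<^bsub>V\<^esub> ?\<Psi> p"] V.smult_closed[OF cl_in_H \<Psi>(1)] by (simp add: \<Phi>_smult \<Psi>)
  have \<Psi>_one: "?\<Psi> 1 = verma_one m l c" using \<Psi>\<Phi>[OF verma_one_in_V] by (simp add: \<Phi>_one)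
  note B = assms(1)[unfolded contravariant_form_def Let_def]
  note B_add = B[THEN conjunct1, rule_format]
    and B_scal = B[THEN conjunct2, THEN conjunct1, rule_format]
    and B_herm = B[THEN conjunct2, THEN conjunct2, THEN conjunct1, rule_format]
    and B_contra = B[THEN conjunct2, THEN conjunct2, THEN conjunct2, THEN conjunct2, THEN conjunct2, rule_format]
  have add: "\<beta> (p + q) r = \<beta> p r + \<beta> q r" for p q r
    by (simp add: \<beta>_def \<Psi>_add B_add \<Psi>(1))
  have scal: "\<beta> (Polynomial.smult z p) r = z * \<beta> p r" for z p r
    by (simp add: \<beta>_def alg_act_fscal[of "dunkl m l c", symmetric] \<Psi>_act B_scal \<Psi>(1))
  have herm: "\<beta> q p = cnj (\<beta> p q)" for p q
    unfolding \<beta>_def by (rule B_herm) (rule \<Psi>(1))+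
  have contra: "\<beta> (act fy p) q = \<beta> p (act fx q)" for p q
    by (simp add: \<beta>_def \<Psi>_act B_contra \<Psi>(1))
  have one: "\<beta> 1 1 = 1"
    using B by (simp only: \<beta>_def \<Psi>_one)
  have const: "\<beta> p 1 = coeff p 0" for p
  proof (cases p)
    case (pCons a q)
    have "act fy 1 = Polynomial.smult 0 1" by (rule poly_eqI) (simp add: coeff_act)
    then have "\<beta> (act fx q) 1 = 0"
      using herm[of 1 "act fx q"] contra[of 1 q] scal[of 0 1 q] by simp
    moreover have "p = Polynomial.smult a 1 + act fx q"
      using pCons by (simp add: alg_act_flet one_pCons)
    ultimately have "\<beta> p 1 = a * 1 + 0" by (simp only: add scal one)
    then show ?thesis using pCons(1) by simp
  qed
  have mono: "\<beta> p (monom 1 n) = gram n * coeff p n" for p n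
  proof (induction n arbitrary: p)
    case 0 show ?case using const[of p] by (simp add: monom_0 one_pCons)
  next
    case (Suc n)
    have "\<beta> p (monom 1 (Suc n)) = \<beta> (act fy p) (monom 1 n)"
    proof -
      have "monom 1 (Suc n) = act fx (monom 1 n)" by (simp add: alg_act_flet monom_Suc)
      then show ?thesis by (simp only: contra)
    qed
    then show ?case using Suc by (simp add: coeff_act gram_Suc)
  qed
  have add2: "\<beta> p (q + r) = \<beta> p q + \<beta> p r" for p q r
    unfolding herm[of p "q + r"] herm[of p q] herm[of p r] add by (rule complex_cnj_add)
  have scal2: "\<beta> p (Polynomial.smult z q) = cnj z * \<beta> p q" for p q z
    unfolding herm[of p "Polynomial.smult z q"] herm[of p q] scal by (rule complex_cnj_mult)
  have sum2: "\<beta> p (sum f A) = (\<Sum>i\<in>A. \<beta> p (f i))" if "finite A" for p A and f :: "nat \<Rightarrow> complex poly"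
    using that scal2[of p 0 0] by (induction A) (simp_all add: add2)
  have "\<beta> p q = shapovalov p q" for p q
  proof -
    have "\<beta> p q = \<beta> p (\<Sum>n\<le>degree q. Polynomial.smult (coeff q n) (monom 1 n))"
      by (simp add: smult_monom poly_as_sum_of_monoms)
    also have "\<dots> = shapovalov p q" by (simp add: sum2 scal2 mono shapovalov_def mult.commute)
    finally show ?thesis .
  qed
  then show ?thesis using \<Psi>\<Phi> u v unfolding \<beta>_def by metis
qed

definition gram_re :: "nat \<Rightarrow> real" where "gram_re n = (\<Prod>k=1..n. real k - Re (bnum m l c k))"

context
  assumes params: "c \<in> params m"
begin

lemma gram_real: "gram n = of_real (gram_re n)"
proof -
  have "\<mu> k = of_real (real k - Re (bnum m l c k))" for k
    using bnum_eq_of_real_Re[OF m_ge_2 primitive params, of k] by (simp add: \<mu>_def)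
  then show ?thesis by (simp add: gram_def gram_re_def)
qed

lemma shapovalov_herm: "shapovalov q p = cnj (shapovalov p q)"
proof -
  have "shapovalov q p = (\<Sum>n\<le>degree q. gram n * coeff q n * cnj (coeff p n))" by (rule shapovalov_eq) simp
  then show ?thesis by (simp add: shapovalov_def gram_real mult_ac)
qed

text \<open>The form is Hermitian because the \<open>\<mu>\<^sub>n\<close> are real; contravariance is the
  recursion \<open>gram (n + 1) = gram n \<sqdot> \<mu>\<^sub>n\<^sub>+\<^sub>1\<close>.\<close>

lemma contravariant_form_exists: "contravariant_form m l c (\<lambda>u v. shapovalov (\<Phi> u) (\<Phi> v))"
  unfolding contravariant_form_def Let_def
proof (intro conjI allI ballI)
  fix u v w z j assume u: "u \<in> carrier V" and v: "v \<in> carrier V"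
  show "shapovalov (\<Phi> (u \<oplus>\<^bsub>V\<^esub> v)) (\<Phi> w) = shapovalov (\<Phi> u) (\<Phi> w) + shapovalov (\<Phi> v) (\<Phi> w)"
    unfolding \<Phi>_add[OF u v] by (rule shapovalov_add)
  show "shapovalov (\<Phi> (cl (fscal z) \<odot>\<^bsub>V\<^esub> u)) (\<Phi> v) = z * shapovalov (\<Phi> u) (\<Phi> v)"
    unfolding \<Phi>_smult[OF u] alg_act_fscal by (rule shapovalov_smult)
  show "shapovalov (\<Phi> v) (\<Phi> u) = cnj (shapovalov (\<Phi> u) (\<Phi> v))" by (rule shapovalov_herm)
  show "shapovalov (\<Phi> (cl (fw j) \<odot>\<^bsub>V\<^esub> u)) (\<Phi> (cl (fw j) \<odot>\<^bsub>V\<^esub> v)) = shapovalov (\<Phi> u) (\<Phi> v)"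
    unfolding \<Phi>_smult[OF u] \<Phi>_smult[OF v] by (rule shapovalov_fw)
  show "shapovalov (\<Phi> (cl fy \<odot>\<^bsub>V\<^esub> u)) (\<Phi> v) = shapovalov (\<Phi> u) (\<Phi> (cl fx \<odot>\<^bsub>V\<^esub> v))"
    unfolding \<Phi>_smult[OF u] \<Phi>_smult[OF v] by (rule shapovalov_fy)
next
  show "shapovalov (\<Phi> (verma_one m l c)) (\<Phi> (verma_one m l c)) = 1" by (simp add: \<Phi>_one shapovalov_def)
qed

text \<open>The form on a coset of the kernel is the form on any representative, and the cosets that are not
  zero are those of the polynomials outside \<open>Rad\<close>.\<close>

lemma unitary_iff_shapovalov: "unitary m l c \<longleftrightarrow> (\<forall>p. p \<notin> Rad \<longrightarrow> shapovalov p p \<in> \<real> \<and> 0 < Re (shapovalov p p))"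
proof -
  let ?R = "{v \<in> carrier V. \<Phi> v \<in> Rad}"
  have R: "submodule ?R H V" by (rule submodule_vimage[OF invariant_Rad])
  have irrep: "irrep m l c = quot_module V ?R" unfolding irrep_def verma_rad_eq by (rule refl)
  have ind: "induced_form B (?R +>\<^bsub>V\<^esub> v) (?R +>\<^bsub>V\<^esub> v) = shapovalov (\<Phi> v) (\<Phi> v)"
    if B: "contravariant_form m l c B" and v: "v \<in> carrier V" for B v
  proof -
    have coset: "w \<in> carrier V \<and> (\<exists>r\<in>Rad. \<Phi> w = r + \<Phi> v)" if w: "w \<in> ?R +>\<^bsub>V\<^esub> v" for w
    proof -
      obtain r where r: "r \<in> ?R" "w = r \<oplus>\<^bsub>V\<^esub> v" using w unfolding a_r_coset_def r_coset_def by auto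
      then have "r \<in> carrier V" "\<Phi> r \<in> Rad" by simp_all
      then show ?thesis using \<Phi>_add[of r v] V.a_closed[of r v] v unfolding r(2) by blast
    qed
    have zero: "shapovalov q r = 0" if "r \<in> Rad" for q r unfolding shapovalov_herm[of q r] shapovalov_Rad[OF that] by simp
    have shapovalov_add2: "shapovalov p (q + r) = shapovalov p q + shapovalov p r" for p q r
      unfolding shapovalov_herm[of p "q + r"] shapovalov_herm[of p q] shapovalov_herm[of p r] shapovalov_add by (rule complex_cnj_add)
    have const: "B w w' = shapovalov (\<Phi> v) (\<Phi> v)" if ww: "w \<in> ?R +>\<^bsub>V\<^esub> v" "w' \<in> ?R +>\<^bsub>V\<^esub> v" for w w'
    proof -
      obtain r r' where "w \<in> carrier V" "w' \<in> carrier V" "r \<in> Rad" "r' \<in> Rad"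
        "\<Phi> w = r + \<Phi> v" "\<Phi> w' = r' + \<Phi> v"
        using coset[OF ww(1)] coset[OF ww(2)] by blast
      then show ?thesis
        using contravariant_form_unique[OF B, of w w'] by (simp add: shapovalov_add shapovalov_add2 shapovalov_Rad zero)
    qed
    have self: "v \<in> ?R +>\<^bsub>V\<^esub> v"
      by (rule abelian_subgroup.a_rcos_self[OF V.submodule_abelian_subgroup[OF R] v])
    show ?thesis
      unfolding induced_form_def
    proof (rule the_equality)
      show "\<forall>u\<in>?R +>\<^bsub>V\<^esub> v. \<forall>w\<in>?R +>\<^bsub>V\<^esub> v. B u w = shapovalov (\<Phi> v) (\<Phi> v)" using const by blast
      fix z assume "\<forall>u\<in>?R +>\<^bsub>V\<^esub> v. \<forall>w\<in>?R +>\<^bsub>V\<^esub> v. B u w = z"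
      then have "B v v = z" using self by blast
      then show "z = shapovalov (\<Phi> v) (\<Phi> v)" unfolding const[OF self self] by (rule sym)
    qed
  qed
  have "positive_definite (irrep m l c) (induced_form B) \<longleftrightarrow> (\<forall>p. p \<notin> Rad \<longrightarrow> shapovalov p p \<in> \<real> \<and> 0 < Re (shapovalov p p))"
    if B: "contravariant_form m l c B" for B
  proof -
    have "positive_definite (irrep m l c) (induced_form B) \<longleftrightarrow>
      (\<forall>v\<in>carrier V. \<Phi> v \<notin> Rad \<longrightarrow> shapovalov (\<Phi> v) (\<Phi> v) \<in> \<real> \<and> 0 < Re (shapovalov (\<Phi> v) (\<Phi> v)))"
      unfolding positive_definite_def irrep V.carrier_quot[OF R] V.zero_quot[OF R]
      unfolding ball_simps
    proof (intro ball_cong refl)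
      fix v assume v: "v \<in> carrier V"
      then have "?R +>\<^bsub>V\<^esub> v \<noteq> ?R \<longleftrightarrow> \<Phi> v \<notin> Rad" using V.coset_eq_self_iff[OF R v] by simp
      then show "(?R +>\<^bsub>V\<^esub> v \<noteq> ?R \<longrightarrow> induced_form B (?R +>\<^bsub>V\<^esub> v) (?R +>\<^bsub>V\<^esub> v) \<in> \<real> \<and>
            0 < Re (induced_form B (?R +>\<^bsub>V\<^esub> v) (?R +>\<^bsub>V\<^esub> v))) \<longleftrightarrow>
          (\<Phi> v \<notin> Rad \<longrightarrow> shapovalov (\<Phi> v) (\<Phi> v) \<in> \<real> \<and> 0 < Re (shapovalov (\<Phi> v) (\<Phi> v)))"
        unfolding ind[OF B v] by simp
    qed
    also have "\<dots> \<longleftrightarrow> (\<forall>p\<in>\<Phi> ` carrier V. p \<notin> Rad \<longrightarrow> shapovalov p p \<in> \<real> \<and> 0 < Re (shapovalov p p))" by simp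
    also have "\<Phi> ` carrier V = UNIV" by (rule bij_betw_imp_surj_on[OF \<Phi>_bij])
    finally show ?thesis by simp
  qed
  then show ?thesis unfolding unitary_def using contravariant_form_exists by blast
qed

text \<open>The powers of \<open>x\<close> are an orthogonal basis, and the classes of those with \<open>gram n \<noteq> 0\<close> are a basis of
  the quotient.\<close>

lemma unitary_iff_gram_nonneg: "unitary m l c \<longleftrightarrow> (\<forall>n. 0 \<le> gram_re n)"
proof -
  have shapovalov_real: "shapovalov p p = of_real (\<Sum>n\<le>degree p. gram_re n * (cmod (coeff p n))\<^sup>2)" for p
    by (simp add: shapovalov_def gram_real mult.assoc complex_norm_square[symmetric])
  show ?thesis unfolding unitary_iff_shapovalov
  proof
    assume *: "\<forall>p. p \<notin> Rad \<longrightarrow> shapovalov p p \<in> \<real> \<and> 0 < Re (shapovalov p p)"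
    have "0 < gram_re n" if "gram_re n \<noteq> 0" for n
    proof -
      have "monom 1 n \<notin> Rad" using that by (auto simp: Rad_def gram_real)
      moreover have "shapovalov (monom 1 n) (monom 1 n) = of_real (gram_re n)"
      proof -
        have "shapovalov (monom 1 n) (monom 1 n) = (\<Sum>i\<le>n. if i = n then of_real (gram_re n) else 0)"
          by (auto simp: shapovalov_def degree_monom_eq gram_real simp del: sum.delta intro!: sum.cong)
        then show ?thesis by simp
      qed
      ultimately show ?thesis using * by fastforce
    qed
    then show "\<forall>n. 0 \<le> gram_re n" by (metis less_eq_real_def)
  next
    assume nonneg: "\<forall>n. 0 \<le> gram_re n"
    have "0 < (\<Sum>n\<le>degree p. gram_re n * (cmod (coeff p n))\<^sup>2)" if p: "p \<notin> Rad" for p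
    proof -
      obtain n where n: "gram_re n \<noteq> 0" "coeff p n \<noteq> 0" using p by (auto simp: Rad_def gram_real)
      then have "0 < gram_re n * (cmod (coeff p n))\<^sup>2" using nonneg by (simp add: less_le)
      moreover have "n \<le> degree p" using n le_degree by blast
      ultimately show ?thesis by (intro sum_pos2[of _ n]) (use nonneg in auto)
    qed
    then show "\<forall>p. p \<notin> Rad \<longrightarrow> shapovalov p p \<in> \<real> \<and> 0 < Re (shapovalov p p)" by (simp add: shapovalov_real)
  qed
qed

end

end

section \<open>Positivity in terms of the coordinates\<close>

lemma first_zero:
  fixes a :: "nat \<Rightarrow> real"
  assumes "\<exists>k\<in>{1..<m}. a k = 0"
  shows "\<exists>N. N \<in> {1..<m} \<and> a N = 0 \<and> (\<forall>k\<in>{1..<N}. a k \<noteq> 0) \<and>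
    (positive_before_first_zero m a \<longleftrightarrow> (\<forall>k\<in>{1..<N}. 0 < a k))"
proof -
  define N where "N = (LEAST k. k \<in> {1..<m} \<and> a k = 0)"
  have N: "N \<in> {1..<m} \<and> a N = 0"
    unfolding N_def by (rule LeastI_ex) (use assms in blast)
  have least: "a k \<noteq> 0" if k: "k \<in> {1..<N}" for k
  proof -
    have "k < N" using k by simp
    then have "\<not> (k \<in> {1..<m} \<and> a k = 0)" unfolding N_def by (rule not_less_Least)
    then show ?thesis using k N by auto
  qed
  have "positive_before_first_zero m a \<longleftrightarrow> (\<forall>k\<in>{1..<N}. 0 < a k)"
    using assms unfolding positive_before_first_zero_def N_def by (simp only: if_True)
  then show ?thesis using N least by blast
qed

text \<open>As long as no factor has vanished, each new factor must be positive to keep the products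
  nonnegative; after a vanishing factor all products are zero. If none of \<open>a 1, \<dots>, a (m - 1)\<close> vanishes,
  the quasi-periodicity and \<open>a m = m\<close> carry positivity of these to all later factors.\<close>

lemma partial_prods_nonneg_iff:
  fixes a :: "nat \<Rightarrow> real"
  assumes m: "m \<ge> 2" and a0: "a 0 = 0" and step: "\<And>k. a (k + m) = a k + real m"
  shows "(\<forall>n. 0 \<le> (\<Prod>k=1..n. a k)) \<longleftrightarrow> positive_before_first_zero m a"
proof
  assume nonneg: "\<forall>n. 0 \<le> (\<Prod>k=1..n. a k)"
  have pos: "0 < a k" if k: "1 \<le> k" and nz: "\<And>j. j \<in> {1..k} \<Longrightarrow> a j \<noteq> 0" for k
  proof -
    obtain i where i: "k = Suc i" using k by (cases k) auto
    have "(\<Prod>j=1..i. a j) \<noteq> 0" using nz by (auto simp: i)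
    then have "0 < (\<Prod>j=1..i. a j)" using nonneg by (metis less_eq_real_def)
    moreover have "0 \<le> (\<Prod>j=1..i. a j) * a k" using nonneg[rule_format, of k] by (simp add: i)
    ultimately have "0 \<le> a k" by (simp add: zero_le_mult_iff)
    then show ?thesis using nz[of k] k by (simp add: less_le)
  qed
  show "positive_before_first_zero m a"
  proof (cases "\<exists>k\<in>{1..<m}. a k = 0")
    case True
    then obtain N where N: "N \<in> {1..<m}" "a N = 0" "\<forall>k\<in>{1..<N}. a k \<noteq> 0"
      "positive_before_first_zero m a \<longleftrightarrow> (\<forall>k\<in>{1..<N}. 0 < a k)" using first_zero[OF True] by blast
    have "0 < a k" if "k \<in> {1..<N}" for k by (rule pos) (use that N(3) in auto)
    then show ?thesis using N(4) by blast
  next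
    case False
    have "0 < a k" if "k \<in> {1..<m}" for k by (rule pos) (use that False in auto)
    then show ?thesis using False by (simp add: positive_before_first_zero_def)
  qed
next
  assume p: "positive_before_first_zero m a"
  show "\<forall>n. 0 \<le> (\<Prod>k=1..n. a k)"
  proof (cases "\<exists>k\<in>{1..<m}. a k = 0")
    case True
    then obtain N where N: "N \<in> {1..<m}" "a N = 0" "\<forall>k\<in>{1..<N}. a k \<noteq> 0"
      "positive_before_first_zero m a \<longleftrightarrow> (\<forall>k\<in>{1..<N}. 0 < a k)" using first_zero[OF True] by blast
    show ?thesis
    proof
      fix n show "0 \<le> (\<Prod>k=1..n. a k)"
      proof (cases "n < N")
        case True
        then show ?thesis using p N(4) by (intro prod_nonneg) (auto intro: less_imp_le)
      next
        case False
        then have "(\<Prod>k=1..n. a k) = 0" using N(1,2) by (intro prod_zero) auto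
        then show ?thesis by (rule eq_refl[OF sym])
      qed
    qed
  next
    case False
    then have pos: "0 < a k" if "k \<in> {1..<m}" for k
      using p that by (auto simp: positive_before_first_zero_def)
    have base: "0 \<le> a k" if "k < m" for k using pos[of k] that a0 by (cases "k = 0") auto
    have "0 \<le> a k" for k
    proof (induction k rule: less_induct)
      case (less k)
      show ?case
      proof (cases "k < m")
        case True then show ?thesis by (rule base)
      next
        case False
        then have "0 \<le> a (k - m)" using m by (intro less) auto
        then show ?thesis using step[of "k - m"] False by simp
      qed
    qed
    then show ?thesis by (simp add: prod_nonneg)
  qed
qed

context cyclic_cherednik
begin

lemma bnum_add_m: "bnum m l c (k + m) = bnum m l c k"
proof -
  have "l ^ (j * (k + m)) = l ^ (j * k)" for j
    by (simp add: distrib_left power_add mult.commute[of j m] power_mult l_pow_m)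
  then show ?thesis by (simp only: bnum_def)
qed

lemma unitary_iff: assumes "c \<in> params m"
  shows "unitary m l c \<longleftrightarrow> positive_before_first_zero m (\<lambda>k. real k - Re (bnum m l c k))"
  unfolding unitary_iff_gram_nonneg[OF assms] gram_re_def
  by (rule partial_prods_nonneg_iff[OF m_ge_2]) (simp_all add: bnum_add_m)

end

lemma positive_before_first_zero_cong:
  assumes "\<And>k. k \<in> {1..<m} \<Longrightarrow> a k = b k"
  shows "positive_before_first_zero m a \<longleftrightarrow> positive_before_first_zero m b"
proof -
  have ex: "(\<exists>k\<in>{1..<m}. a k = 0) \<longleftrightarrow> (\<exists>k\<in>{1..<m}. b k = 0)" using assms by auto
  have L: "(\<lambda>k. k \<in> {1..<m} \<and> a k = 0) = (\<lambda>k. k \<in> {1..<m} \<and> b k = 0)" using assms by auto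
  have lt: "(LEAST k. k \<in> {1..<m} \<and> b k = 0) < m" if "\<exists>k\<in>{1..<m}. b k = 0"
  proof -
    have "(LEAST k. k \<in> {1..<m} \<and> b k = 0) \<in> {1..<m} \<and> b (LEAST k. k \<in> {1..<m} \<and> b k = 0) = 0"
      by (rule LeastI_ex) (use that in blast)
    then show ?thesis by simp
  qed
  have below: "(\<forall>k\<in>{1..<N}. 0 < a k) \<longleftrightarrow> (\<forall>k\<in>{1..<N}. 0 < b k)" if "N \<le> m" for N
    using assms that by auto
  show ?thesis
  proof (cases "\<exists>k\<in>{1..<m}. b k = 0")
    case True
    then show ?thesis
      unfolding positive_before_first_zero_def ex L by (simp only: if_True below[OF less_imp_le[OF lt[OF True]]])
  next
    case False
    then show ?thesis
      unfolding positive_before_first_zero_def ex L by (simp only: if_False below[OF order_refl])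
  qed
qed

section \<open>The coordinates\<close>

context cyclic_cherednik
begin

lemma orthogonality:
  assumes "i < m" "k < m"
  shows "(\<Sum>n<m. l ^ (i * n) / l ^ (k * n)) = (if i = k then of_nat m else 0)"
proof -
  define z where "z = l ^ i / l ^ k"
  have "l ^ (i * n) / l ^ (k * n) = z ^ n" for n by (simp add: z_def power_mult power_divide)
  moreover have "z ^ m = (l ^ m) ^ i / (l ^ m) ^ k"
    by (simp add: z_def power_divide power_mult[symmetric] mult.commute)
  then have "z ^ m = 1" by (simp add: l_pow_m)
  moreover have "i = k" if "z = 1"
  proof (rule ccontr)
    assume "i \<noteq> k"
    then consider "i < k" | "k < i" by linarith
    then show False
    proof cases
      case 1
      then have "l ^ k = l ^ i * l ^ (k - i)" by (simp add: power_add[symmetric])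
      then have "l ^ (k - i) = 1" using that l_nonzero by (simp add: z_def)
      then show False using l_pow_neq_1[of "k - i"] 1 assms by simp
    next
      case 2
      then have "l ^ i = l ^ k * l ^ (i - k)" by (simp add: power_add[symmetric])
      then have "l ^ (i - k) = 1" using that l_nonzero by (simp add: z_def)
      then show False using l_pow_neq_1[of "i - k"] 2 assms by simp
    qed
  qed
  moreover have "z = 1" if "i = k" using that l_nonzero by (simp add: z_def)
  ultimately show ?thesis using geometric_sum[of z m] by (cases "z = 1") auto
qed

lemma fourier_inversion:
  assumes "k < m"
  shows "(\<Sum>n<m. (\<Sum>j<m. f j * l ^ (j * n)) / l ^ (k * n)) = of_nat m * f k"
proof -
  have "(\<Sum>n<m. (\<Sum>j<m. f j * l ^ (j * n)) / l ^ (k * n)) = (\<Sum>n<m. \<Sum>j<m. f j * (l ^ (j * n) / l ^ (k * n)))"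
    by (simp add: sum_divide_distrib)
  also have "\<dots> = (\<Sum>j<m. f j * (\<Sum>n<m. l ^ (j * n) / l ^ (k * n)))"
    by (subst sum.swap) (simp add: sum_distrib_left)
  also have "\<dots> = (\<Sum>j<m. if j = k then of_nat m * f k else 0)"
    using assms by (intro sum.cong refl) (simp add: orthogonality)
  finally show ?thesis using assms by simp
qed

lemma fourier_inversion':
  assumes "n < m"
  shows "(\<Sum>j<m. (\<Sum>k<m. d k / l ^ (j * k)) * l ^ (j * n)) = of_nat m * d n"
proof -
  have "(\<Sum>j<m. (\<Sum>k<m. d k / l ^ (j * k)) * l ^ (j * n)) = (\<Sum>j<m. \<Sum>k<m. d k * (l ^ (n * j) / l ^ (k * j)))"
    unfolding sum_distrib_right by (intro sum.cong refl) (simp add: mult.commute)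
  also have "\<dots> = (\<Sum>k<m. d k * (\<Sum>j<m. l ^ (n * j) / l ^ (k * j)))"
    by (subst sum.swap) (simp add: sum_distrib_left)
  also have "\<dots> = (\<Sum>k<m. if k = n then of_nat m * d n else 0)"
    using assms by (intro sum.cong refl) (simp add: orthogonality)
  finally show ?thesis using assms by simp
qed

lemma sum_from_1: "f 0 = 0 \<Longrightarrow> (\<Sum>j=1..m-1. f j) = (\<Sum>j<m. f j)" for f :: "nat \<Rightarrow> complex"
proof -
  assume "f 0 = 0"
  moreover have "{..<m} = insert 0 {1..m-1}" using m_ge_2 by auto
  ultimately show ?thesis by simp
qed

text \<open>By \<open>bnum_Suc\<close> the halved differences of the \<open>b\<^sub>n\<close> are the Fourier transform of \<open>c\<close>, extended by \<open>0\<close>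
  at the identity of \<open>W\<close>.\<close>

lemma param_from_bnum:
  assumes "0 < k" "k < m"
  shows "of_nat m * c k = (\<Sum>n<m. (bnum m l c (Suc n) - bnum m l c n) / 2 / l ^ (k * n))"
proof -
  let ?f = "\<lambda>j. if j = 0 then 0 else c j"
  have "(\<Sum>j=1..m-1. c j * l ^ (j * n)) = (\<Sum>j<m. ?f j * l ^ (j * n))" for n
    by (subst sum_from_1[symmetric]) (auto intro!: sum.cong)
  then show ?thesis using fourier_inversion[of k ?f] assms by (simp add: bnum_Suc)
qed

lemma cnj_l_pow: "cnj (l ^ j) = 1 / l ^ j"
proof -
  have "l ^ j * cnj (l ^ j) = 1" using complex_norm_square[of "l ^ j"] by (simp add: norm_power norm_l)
  then show ?thesis using l_nonzero by (simp add: field_simps)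
qed

end

lemma bcoords_inj:
  assumes m: "m \<ge> 2" and l: "primitive_root_of_unity m l"
  shows "inj_on (bcoords m l) (params m)"
proof (rule inj_onI)
  fix c c' assume c: "c \<in> params m" and c': "c' \<in> params m" and eq: "bcoords m l c = bcoords m l c'"
  interpret A: cyclic_cherednik m l c by unfold_locales (rule m l)+
  interpret B: cyclic_cherednik m l c' by unfold_locales (rule m l)+
  have "Re (bnum m l c n) = Re (bnum m l c' n)" if "n \<in> {1..<m}" for n
    using fun_cong[OF eq, of n] that by (simp add: bcoords_def)
  then have lt: "bnum m l c n = bnum m l c' n" if "n \<in> {1..<m}" for n
    using that bnum_eq_of_real_Re[OF m l c, of n] bnum_eq_of_real_Re[OF m l c', of n] by metis
  have b: "bnum m l c n = bnum m l c' n" if n: "n \<le> m" for n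
  proof -
    consider "n = 0" | "n = m" | "n \<in> {1..<m}" using n by fastforce
    then show ?thesis using lt A.bnum_add_m[of 0] B.bnum_add_m[of 0] by cases auto
  qed
  have "c k = c' k" if "k \<in> {1..<m}" for k
  proof -
    have k: "0 < k" "k < m" using that by auto
    have "of_nat m * c k = of_nat m * c' k"
      unfolding A.param_from_bnum[OF k] B.param_from_bnum[OF k]
      by (rule sum.cong[OF refl]) (simp add: b)
    then show ?thesis using m by simp
  qed
  then show "c = c'" using c c' unfolding params_def by (metis (no_types, lifting) Int_iff PiE_ext mem_Collect_eq)
qed

text \<open>The inverse transform of the halved differences of the given numbers. Its value at \<open>0\<close> vanishes
  because the differences over a full period, starting and ending at \<open>b\<^sub>0 = b\<^sub>m = 0\<close>, add up to zero;
  reality of the numbers gives \<open>c\<^sub>m\<^sub>-\<^sub>j\<close> conjugate to \<open>c\<^sub>j\<close>.\<close>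

lemma bcoords_surj:
  assumes m: "m \<ge> 2" and l: "primitive_root_of_unity m l" and b: "b \<in> {1..<m} \<rightarrow>\<^sub>E (UNIV :: real set)"
  shows "\<exists>c\<in>params m. bcoords m l c = b"
proof -
  \<comment> \<open>The values \<open>b\<^sub>0, \<dots>, b\<^sub>m\<close> to be attained: the given ones, and \<open>0\<close> at both ends of the period.\<close>
  define e where "e n = (if n \<in> {1..<m} then b n else 0)" for n
  define d where "d n = complex_of_real ((e (Suc n) - e n) / 2)" for n
  define f where "f j = (\<Sum>k<m. d k / l ^ (j * k)) / of_nat m" for j
  define c where "c = restrict f {1..<m}"
  interpret cyclic_cherednik m l c by unfold_locales (rule m l)+
  have "f (m - j) = cnj (f j)" if j: "j \<in> {1..<m}" for j
  proof -
    have "l ^ ((m - j) * k) * l ^ (j * k) = 1" for k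
    proof -
      have "l ^ ((m - j) * k) * l ^ (j * k) = l ^ (m * k)"
        using j by (simp add: power_add[symmetric] distrib_right[symmetric])
      then show ?thesis by (simp add: power_mult l_pow_m)
    qed
    moreover have "1 / x = y" if "x * y = 1" for x y :: complex
      using that by (cases "x = 0") (auto simp: field_simps)
    ultimately have "1 / l ^ ((m - j) * k) = l ^ (j * k)" for k by blast
    note inv = this
    have "d k / l ^ ((m - j) * k) = cnj (d k / l ^ (j * k))" for k
    proof -
      have "cnj (d k / l ^ (j * k)) = d k / (1 / l ^ (j * k))"
        unfolding complex_cnj_divide cnj_l_pow by (simp add: d_def)
      also have "\<dots> = d k * (1 / l ^ ((m - j) * k))" unfolding inv by simp
      finally show ?thesis by simp
    qed
    then show ?thesis by (simp add: f_def)
  qed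
  then have params: "c \<in> params m" by (auto simp: params_def c_def)
  have "(\<Sum>k<n. d k) = of_real ((e n - e 0) / 2)" for n
    by (induction n) (simp_all add: d_def diff_divide_distrib)
  from this[of m] have f0: "f 0 = 0" by (simp add: f_def e_def)
  have bnum: "bnum m l c n = e n" if "n \<le> m" for n
    using that
  proof (induction n)
    case (Suc n)
    have "(\<Sum>j=1..m-1. c j * l ^ (j * n)) = (\<Sum>j=1..m-1. f j * l ^ (j * n))"
      by (rule sum.cong) (auto simp: c_def)
    also have "\<dots> = (\<Sum>j<m. f j * l ^ (j * n))" by (rule sum_from_1) (simp add: f0)
    also have "\<dots> = (\<Sum>j<m. (\<Sum>k<m. d k / l ^ (j * k)) * l ^ (j * n)) / of_nat m"
    proof -
      have "f j * l ^ (j * n) = (\<Sum>k<m. d k / l ^ (j * k)) * l ^ (j * n) / of_nat m" for j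
        by (simp add: f_def)
      then show ?thesis by (simp only: sum_divide_distrib)
    qed
    also have "\<dots> = d n" using Suc.prems m by (simp add: fourier_inversion')
    finally have "bnum m l c (Suc n) - bnum m l c n = 2 * d n" by (simp add: bnum_Suc)
    then show ?case using Suc by (simp add: d_def algebra_simps)
  qed (simp add: e_def)
  have "bcoords m l c n = b n" for n
  proof (cases "n \<in> {1..<m}")
    case True
    then have "bnum m l c n = of_real (b n)" using bnum[of n] by (simp add: e_def)
    then show ?thesis using True by (simp add: bcoords_def)
  next
    case False
    show ?thesis unfolding PiE_arb[OF b False] by (simp only: bcoords_def restrict_apply False if_False)
  qed
  then have "bcoords m l c = b" by (rule ext)
  then show ?thesis using params by blast
qed

theorem corollary3p11:
  fixes m :: nat and l :: complex
  assumes "m \<ge> 2" and "primitive_root_of_unity m l"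
  shows "bij_betw (bcoords m l) (params m) ({1..<m} \<rightarrow>\<^sub>E UNIV) \<and>
         bcoords m l ` unitary_params m l =
           {b \<in> {1..<m} \<rightarrow>\<^sub>E UNIV. positive_before_first_zero m (\<lambda>k. real k - b k)}"
proof
  have mem: "bcoords m l c \<in> {1..<m} \<rightarrow>\<^sub>E UNIV" for c by (simp add: bcoords_def)
  then have "bcoords m l ` params m = {1..<m} \<rightarrow>\<^sub>E UNIV"
    using bcoords_surj[OF assms] by blast
  then show "bij_betw (bcoords m l) (params m) ({1..<m} \<rightarrow>\<^sub>E UNIV)"
    using bcoords_inj[OF assms] by (simp add: bij_betw_def)
  have unitary: "unitary m l c \<longleftrightarrow> positive_before_first_zero m (\<lambda>k. real k - bcoords m l c k)"
    if "c \<in> params m" for c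
  proof -
    interpret cyclic_cherednik m l c by unfold_locales (rule assms)+
    show ?thesis unfolding unitary_iff[OF that]
      by (rule positive_before_first_zero_cong) (simp add: bcoords_def)
  qed
  show "bcoords m l ` unitary_params m l =
      {b \<in> {1..<m} \<rightarrow>\<^sub>E UNIV. positive_before_first_zero m (\<lambda>k. real k - b k)}"
  proof (intro equalityI subsetI)
    fix b assume "b \<in> bcoords m l ` unitary_params m l"
    then show "b \<in> {b \<in> {1..<m} \<rightarrow>\<^sub>E UNIV. positive_before_first_zero m (\<lambda>k. real k - b k)}"
      using mem unitary by (auto simp: unitary_params_def)
  next
    fix b assume b: "b \<in> {b \<in> {1..<m} \<rightarrow>\<^sub>E UNIV. positive_before_first_zero m (\<lambda>k. real k - b k)}"
    then obtain c where "c \<in> params m" "bcoords m l c = b" using bcoords_surj[OF assms] by blast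
    then show "b \<in> bcoords m l ` unitary_params m l"
      using b unitary[of c] by (auto simp: unitary_params_def)
  qed
qed

end
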